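(* Let $\mathcal H$ be a complex Hilbert space, let $k$ be a positive integer with $k<\dim\mathcal H$, and let $\mathbf A=(A_1,\dots,A_m)$ be an $m$-tuple of bounded self-adjoint operators on $\mathcal H$. (i) If $m\le 3$ and $W_{k+1}(\mathbf A)$ is closed, then $W_k(\mathbf A)$ is closed. (ii) If $m\ge 4$ and $\operatorname{conv}W_{k+1}(\mathbf A)$ is closed (in particular, if $W_{k+1}(\mathbf A)$ is closed), then $\operatorname{conv}W_k(\mathbf A)$ is closed.
   Context: For an $m$-tuple $\mathbf A=(A_1,\dots,A_m)$ of bounded operators on $\mathcal H$ and a positive integer $k\le\dim\mathcal H$, the joint $k$-numerical range is $$W_k(\mathbf A)=\Big\{\Big(\sum_{\ell=1}^k\langle A_1x_\ell,x_\ell\rangle,\dots,\sum_{\ell=1}^k\langle A_mx_\ell,x_\ell\rangle\Big):\{x_1,\dots,x_k\}\subseteq\mathcal H\text{ orthonormal}\Big\}.$$ $\operatorname{conv}$ denotes convex hull. *)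

theory Defs
  imports "HOL-Analysis.Analysis" "HOL-Library.Extended_Nat"
begin

text \<open>
  Complex inner product spaces, built on top of \<^class>\<open>real_inner\<close> so that norm, topology and
  completeness are the library's. The inner product is linear in its first argument, and its real
  part is the real inner product; positive definiteness and
  \<open>norm x = sqrt (Re (cinner x x))\<close> follow from the axioms of \<^class>\<open>real_inner\<close>.
\<close>

class complex_inner = real_inner +
  fixes scaleC :: "complex \<Rightarrow> 'a \<Rightarrow> 'a" (infixr "*\<^sub>C" 75)
    and cinner :: "'a \<Rightarrow> 'a \<Rightarrow> complex"
  assumes scaleC_add_right: "a *\<^sub>C (x + y) = a *\<^sub>C x + a *\<^sub>C y"
    and scaleC_add_left: "(a + b) *\<^sub>C x = a *\<^sub>C x + b *\<^sub>C x"
    and scaleC_scaleC: "a *\<^sub>C (b *\<^sub>C x) = (a * b) *\<^sub>C x"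
    and scaleC_of_real: "complex_of_real r *\<^sub>C x = r *\<^sub>R x"
    and cinner_commute: "cinner x y = cnj (cinner y x)"
    and cinner_add_left: "cinner (x + y) z = cinner x z + cinner y z"
    and cinner_scaleC_left: "cinner (a *\<^sub>C x) y = a * cinner x y"
    and Re_cinner: "Re (cinner x y) = inner x y"

class chilbert_space = complex_inner + complete_space

lemma scaleC_one: "1 *\<^sub>C x = (x :: 'a::complex_inner)"
  using scaleC_of_real[of 1 x] by simp

global_interpretation cvec: vector_space "scaleC :: complex \<Rightarrow> 'a \<Rightarrow> 'a::complex_inner"
  by unfold_locales
    (simp_all add: scaleC_add_right scaleC_add_left scaleC_scaleC scaleC_one)

text \<open>
  \<open>cvec.dim\<close> is \<open>0\<close> on infinite-dimensional spaces, hence the explicit case distinction.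
  All infinite dimensions are identified, as dimensions are only compared with natural numbers.
\<close>

definition cdimension :: "'a::complex_inner itself \<Rightarrow> enat" where
  "cdimension _ =
    (if \<exists>B :: 'a set. finite B \<and> cvec.span B = UNIV
     then enat (cvec.dim (UNIV :: 'a set)) else \<infinity>)"

definition bounded_clinear :: "('a::complex_inner \<Rightarrow> 'b::complex_inner) \<Rightarrow> bool" where
  "bounded_clinear T \<longleftrightarrow> bounded_linear T \<and> (\<forall>c x. T (c *\<^sub>C x) = c *\<^sub>C T x)"

definition selfadjoint_op :: "('a::complex_inner \<Rightarrow> 'a) \<Rightarrow> bool" where
  "selfadjoint_op T \<longleftrightarrow> bounded_clinear T \<and> (\<forall>x y. cinner (T x) y = cinner x (T y))"

definition corthonormal :: "nat \<Rightarrow> (nat \<Rightarrow> 'a::complex_inner) \<Rightarrow> bool" where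
  "corthonormal k x \<longleftrightarrow>
    (\<forall>i\<in>{1..k}. \<forall>j\<in>{1..k}. cinner (x i) (x j) = (if i = j then 1 else 0))"

text \<open>
  An \<open>m\<close>-tuple of operators is a family indexed by a finite type with \<open>m\<close> elements. The range
  is taken in complex coordinate space also for self-adjoint operators, where all coordinates
  are real.
\<close>

definition joint_num_range ::
    "nat \<Rightarrow> ('m::finite \<Rightarrow> 'a::complex_inner \<Rightarrow> 'a) \<Rightarrow> (complex ^ 'm) set" where
  "joint_num_range k A =
    {(\<chi> j. \<Sum>l=1..k. cinner (A j (x l)) (x l)) | x. corthonormal k x}"

end

theory Submission
  imports Defs
begin

text \<open>
  Let \<open>K\<^sub>k\<close> be the set of tuples \<open>(tr (A\<^sub>j D))\<^sub>j\<close> over finite-rank \<open>0 \<le> D \<le> I\<close> of trace \<open>k\<close>; by the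
  spectral theorem \<open>K\<^sub>k = conv W\<^sub>k\<close>. For \<open>m \<le> 3\<close> and infinite dimension even \<open>K\<^sub>k = W\<^sub>k\<close>: two
  eigenvectors of \<open>D\<close> with fractional eigenvalues can be merged, since the segments from the value
  at a far-away vector to an ellipsoid surface in \<open>\<real>\<^sup>3\<close> fill the solid ellipsoid.

  Let \<open>p\<close> be a limit of values at orthonormal \<open>k\<close>-tuples, with weak limits \<open>x\<^sub>l\<close>, and put
  \<open>D = \<Sum> x\<^sub>l \<otimes> x\<^sub>l\<close>, \<open>\<sigma> = k - tr D\<close>. If \<open>\<sigma> = 0\<close>, convergence is strong and \<open>p \<in> W\<^sub>k\<close>. Otherwise
  \<open>p = tr (A D) + v\<close> where \<open>v\<close> is carried by weakly null vectors of total mass \<open>\<sigma>\<close>. Spreading more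
  of this mass over many far-away blocks gives \<open>tr (A D) + ((\<sigma> + 1) / \<sigma>) v \<in> closure K\<^sub>k\<^sub>+\<^sub>1\<close>. If
  \<open>K\<^sub>k\<^sub>+\<^sub>1\<close> is closed, this point is \<open>tr (A E)\<close> for some \<open>0 \<le> E \<le> I\<close> of trace \<open>k + 1\<close>, and \<open>p\<close> is the
  value at the convex combination of \<open>D\<close> and \<open>E\<close> of trace \<open>k\<close>.
\<close>

subsection \<open>Complex inner products\<close>

lemma scaleR_scaleC: "r *\<^sub>R x = complex_of_real r *\<^sub>C (x :: 'a::complex_inner)"
  by (simp add: scaleC_of_real)

lemma cinner_scaleR_left [simp]: "cinner (r *\<^sub>R x) y = of_real r * cinner x y"
  by (simp add: scaleR_scaleC cinner_scaleC_left)

lemma cinner_add_right: "cinner x (y + z) = cinner x y + cinner x z"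
  by (subst (1 2 3) cinner_commute) (simp add: cinner_add_left)

lemma cinner_scaleC_right: "cinner x (a *\<^sub>C y) = cnj a * cinner x y"
  by (subst (1 2) cinner_commute) (simp add: cinner_scaleC_left)

lemma cinner_scaleR_right [simp]: "cinner x (r *\<^sub>R y) = of_real r * cinner x y"
  by (simp add: scaleR_scaleC cinner_scaleC_right)

lemma cinner_zero_left [simp]: "cinner 0 x = 0"
  using cinner_scaleR_left[of 0 0 x] by simp

lemma cinner_zero_right [simp]: "cinner x 0 = 0"
  using cinner_scaleR_right[of x 0 0] by simp

lemma cinner_minus_left: "cinner (- x) y = - cinner x y"
  using cinner_scaleR_left[of "-1" x y] by simp

lemma cinner_minus_right: "cinner x (- y) = - cinner x y"
  using cinner_scaleR_right[of x "-1" y] by simp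

lemma cinner_diff_left: "cinner (x - y) z = cinner x z - cinner y z"
  using cinner_add_left[of x "-y" z] by (simp add: cinner_minus_left)

lemma cinner_diff_right: "cinner x (y - z) = cinner x y - cinner x z"
  using cinner_add_right[of x y "-z"] by (simp add: cinner_minus_right)

lemma cinner_sum_left: "cinner (\<Sum>i\<in>I. f i) y = (\<Sum>i\<in>I. cinner (f i) y)"
  by (induction I rule: infinite_finite_induct) (auto simp: cinner_add_left)

lemma cinner_sum_list_right: "cinner y (\<Sum>i\<leftarrow>xs. f i) = (\<Sum>i\<leftarrow>xs. cinner y (f i))"
  by (induction xs) (auto simp: cinner_add_right)

lemma cinner_self: "cinner x x = of_real ((norm x)\<^sup>2)"
proof -
  have "cnj (cinner x x) = cinner x x" by (metis cinner_commute)
  then have "Im (cinner x x) = 0" by (simp add: complex_eq_iff)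
  then show ?thesis by (simp add: complex_eq_iff Re_cinner power2_norm_eq_inner)
qed

lemma cinner_eq_zero_commute: "cinner x y = 0 \<longleftrightarrow> cinner y x = 0"
  by (metis cinner_commute complex_cnj_zero)

lemma norm_scaleC: "norm (a *\<^sub>C x) = cmod a * norm (x :: 'a::complex_inner)"
proof -
  have "of_real ((norm (a *\<^sub>C x))\<^sup>2) = a * cnj a * cinner x x"
    unfolding cinner_self[symmetric] by (simp add: cinner_scaleC_left cinner_scaleC_right)
  also have "\<dots> = of_real ((cmod a * norm x)\<^sup>2)"
    by (simp only: cinner_self power_mult_distrib of_real_mult complex_norm_square[symmetric])
  finally have "of_real ((norm (a *\<^sub>C x))\<^sup>2) = (of_real ((cmod a * norm x)\<^sup>2) :: complex)" .
  then have "(norm (a *\<^sub>C x))\<^sup>2 = (cmod a * norm x)\<^sup>2"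
    by (simp only: of_real_eq_iff)
  then show ?thesis by (simp add: power2_eq_iff_nonneg)
qed

text \<open>Rotating \<open>x\<close> by a phase makes the inner product real and nonnegative, which
  reduces the claim to the real inequality.\<close>

lemma cinner_cauchy_schwarz: "cmod (cinner x y) \<le> norm x * norm y"
proof (cases "cinner x y = 0")
  case False
  let ?c = "cinner x y"
  let ?u = "cnj ?c / of_real (cmod ?c)"
  have u: "cmod ?u = 1" using False by (simp add: norm_divide)
  have "cmod ?c = Re (?u * ?c)"
    using False by (simp add: complex_norm_square[symmetric] power2_eq_square mult.commute)
  also have "\<dots> = inner (?u *\<^sub>C x) y" by (simp add: Re_cinner[symmetric] cinner_scaleC_left)
  also have "\<dots> \<le> norm (?u *\<^sub>C x) * norm y" by (rule norm_cauchy_schwarz)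
  finally show ?thesis by (simp only: norm_scaleC u mult_1)
qed simp

lemma Im_cinner: "Im (cinner x y) = inner x (\<i> *\<^sub>C y)"
  by (simp add: Re_cinner[symmetric] cinner_scaleC_right)

text \<open>Testing against \<open>\<i> *\<^sub>C z\<close> as well as \<open>z\<close> recovers the
  imaginary part, so weak limits formed with the real inner product control the complex one.\<close>

lemma tendsto_cinner_left:
  assumes "\<And>z. ((\<lambda>n. inner (x n) z) \<longlongrightarrow> inner l z) F"
  shows "((\<lambda>n. cinner (x n) z) \<longlongrightarrow> cinner l z) F"
proof -
  have "cinner v z = Complex (inner v z) (inner v (\<i> *\<^sub>C z))" for v
    by (simp add: complex_eq_iff Re_cinner Im_cinner)
  then show ?thesis by (simp add: tendsto_Complex assms)
qed

lemma norm_add_orthogonal: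
  assumes "cinner x y = 0"
  shows "(norm (x + y))\<^sup>2 = (norm x)\<^sup>2 + (norm y)\<^sup>2"
proof -
  have "inner x y = 0" using assms by (simp add: Re_cinner[symmetric])
  then show ?thesis by (simp add: power2_norm_eq_inner inner_add_left inner_add_right inner_commute)
qed

subsection \<open>Weak compactness\<close>

text \<open>First-order condition at a minimum: for small \<open>t\<close> of suitable sign a linear
  term would dominate. It is the variational step for the Riesz functional and for the top
  eigenvector.\<close>

lemma linear_coeff_zero_if_quadratic_nonneg:
  fixes c s :: real
  assumes "\<And>t. 0 \<le> 2 * t * c + t\<^sup>2 * s"
  shows "c = 0"
proof (rule ccontr)
  assume "c \<noteq> 0"
  define r where "r = \<bar>s\<bar> + 1"
  have r: "r > 0" "s < 2 * r" by (auto simp: r_def)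
  have "0 \<le> 2 * (- (c / r)) * c + (- (c / r))\<^sup>2 * s" by (rule assms)
  also have "\<dots> = (c / r)\<^sup>2 * (s - 2 * r)" using r by (simp add: field_simps power2_eq_square)
  finally show False using r \<open>c \<noteq> 0\<close> by (simp add: zero_le_mult_iff)
qed

text \<open>The representing vector minimises \<open>z \<mapsto> \<parallel>z\<parallel>\<^sup>2 - 2 \<phi> z\<close>.\<close>

lemma riesz_representation:
  fixes \<phi> :: "'a::{real_inner,complete_space} \<Rightarrow> real"
  assumes "bounded_linear \<phi>"
  shows "\<exists>x. \<forall>z. \<phi> z = inner x z"
proof -
  interpret bounded_linear \<phi> by fact
  obtain K where K: "\<And>z. norm (\<phi> z) \<le> norm z * K" using bounded by blast
  define J where "J z = (norm z)\<^sup>2 - 2 * \<phi> z" for z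
  have "- K\<^sup>2 \<le> J z" for z
  proof -
    have "0 \<le> (norm z - K)\<^sup>2" by simp
    moreover have "\<phi> z \<le> norm z * K" using K[of z] by simp
    ultimately show ?thesis by (simp add: J_def power2_diff)
  qed
  then have bdd: "bdd_below (range J)" by (intro bdd_belowI) auto
  define m where "m = Inf (range J)"
  have m_le: "m \<le> J z" for z unfolding m_def by (rule cInf_lower) (use bdd in auto)
  have "\<exists>z. J z < m + 1 / Suc n" for n
  proof -
    have "Inf (range J) < m + 1 / Suc n" by (simp add: m_def)
    then show ?thesis using cInf_lessD[of "range J"] by auto
  qed
  then obtain s where s: "\<And>n. J (s n) < m + 1 / Suc n" by metis
  \<comment> \<open>The parallelogram law applied at the midpoint, whose value is at least
    \<open>m\<close>; it makes every minimising sequence Cauchy.\<close>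
  have par: "(norm (z - w))\<^sup>2 \<le> 2 * (J z - m) + 2 * (J w - m)" for z w
  proof -
    have "2 * J z + 2 * J w - 4 * J ((1/2) *\<^sub>R (z + w)) = (norm (z - w))\<^sup>2"
      by (simp add: J_def scaleR add power2_norm_eq_inner inner_add_left inner_add_right
          inner_diff_left inner_diff_right inner_commute algebra_simps)
    then show ?thesis using m_le[of "(1/2) *\<^sub>R (z + w)"] by simp
  qed
  have "Cauchy s"
  proof (rule metric_CauchyI)
    fix e :: real assume "0 < e"
    then obtain N where N: "1 / real (Suc N) < e\<^sup>2 / 4"
      using reals_Archimedean[of "e\<^sup>2 / 4"] by (auto simp: inverse_eq_divide)
    have "dist (s i) (s j) < e" if "i \<ge> N" "j \<ge> N" for i j
    proof -
      have small: "J (s n) - m < e\<^sup>2 / 4" if "n \<ge> N" for n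
      proof -
        have "1 / real (Suc n) \<le> 1 / real (Suc N)" using that by (simp add: frac_le)
        then show ?thesis using s[of n] N by linarith
      qed
      have "(norm (s i - s j))\<^sup>2 < e\<^sup>2"
        using par[of "s i" "s j"] small[OF that(1)] small[OF that(2)]
        by (simp add: field_simps)
      then show ?thesis using \<open>0 < e\<close> by (simp add: dist_norm power2_less_imp_less)
    qed
    then show "\<exists>M. \<forall>m\<ge>M. \<forall>n\<ge>M. dist (s m) (s n) < e" by blast
  qed
  then obtain x where x: "s \<longlonglongrightarrow> x" using Cauchy_convergent convergent_def by blast
  have "(\<lambda>n. J (s n)) \<longlonglongrightarrow> J x" unfolding J_def
    by (rule tendsto_diff[OF tendsto_power[OF tendsto_norm[OF x]] tendsto_mult_left[OF tendsto[OF x]]])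
  moreover have "(\<lambda>n. m + 1 / Suc n) \<longlonglongrightarrow> m + 0"
    by (intro tendsto_intros LIMSEQ_Suc[OF lim_1_over_n])
  ultimately have Jx: "J x \<le> m"
    by (intro LIMSEQ_le[where X = "\<lambda>n. J (s n)" and Y = "\<lambda>n. m + 1 / Suc n"])
      (use s in \<open>auto intro: less_imp_le\<close>)
  have "\<phi> z = inner x z" for z
  proof -
    define c where "c = inner x z - \<phi> z"
    have "J (x - r *\<^sub>R z) - J x = r\<^sup>2 * (norm z)\<^sup>2 - 2 * r * c" for r
      by (simp add: J_def c_def diff scaleR power2_norm_eq_inner inner_diff_left inner_diff_right
          inner_commute power2_eq_square[of r] algebra_simps)
    then have eq: "J (x - (- r) *\<^sub>R z) - J x = (- r)\<^sup>2 * (norm z)\<^sup>2 - 2 * (- r) * c" for r .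
    have "0 \<le> 2 * r * c + r\<^sup>2 * (norm z)\<^sup>2" for r
      using eq[of r] Jx m_le[of "x - (- r) *\<^sub>R z"] by simp
    then have "c = 0" by (rule linear_coeff_zero_if_quadratic_nonneg)
    then show ?thesis by (simp add: c_def)
  qed
  then show ?thesis by blast
qed

text \<open>Banach-Alaoglu in Hilbert space: the functionals \<open>inner (x n)\<close> lie in a
  product of compact intervals, and Riesz represents their cluster point. Tychonoff yields a cluster
  point rather than a subsequence, hence the finer filter \<open>G\<close>.\<close>

lemma weak_cluster:
  fixes x :: "'b \<Rightarrow> 'a::{real_inner,complete_space}"
  assumes F: "F \<noteq> bot" and C: "\<And>n. norm (x n) \<le> C"
  shows "\<exists>G l. G \<le> F \<and> G \<noteq> bot \<and> (\<forall>z. ((\<lambda>n. inner (x n) z) \<longlongrightarrow> inner l z) G)"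
proof -
  define f where "f n z = inner (x n) z" for n z
  define B :: "('a \<Rightarrow> real) set" where "B = (\<Pi>\<^sub>E z\<in>UNIV. {- C * norm z .. C * norm z})"
  have "compactin (product_topology (\<lambda>_::'a. euclideanreal) UNIV) B"
    unfolding B_def by (subst compactin_PiE) auto
  then have "compact B" by (simp add: euclidean_product_topology)
  moreover have "eventually (\<lambda>g. g \<in> B) (filtermap f F)"
  proof -
    have "f n \<in> B" for n
    proof -
      have "\<bar>inner (x n) z\<bar> \<le> C * norm z" for z
        using Cauchy_Schwarz_ineq2[of "x n" z] mult_right_mono[OF C[of n] norm_ge_zero[of z]]
        by linarith
      then show ?thesis by (simp add: B_def f_def PiE_iff abs_le_iff minus_le_iff)
    qed
    then show ?thesis by (simp add: eventually_filtermap)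
  qed
  moreover have "filtermap f F \<noteq> bot" using F by (simp add: filtermap_bot_iff)
  ultimately obtain \<phi> where \<phi>: "inf (nhds \<phi>) (filtermap f F) \<noteq> bot"
    unfolding compact_filter by blast
  \<comment> \<open>Restricting \<open>F\<close> to the preimages of neighbourhoods of the cluster
    point \<open>\<phi>\<close> forces convergence to \<open>\<phi>\<close>; properness of
    \<open>G\<close> is exactly the cluster property.\<close>
  define G where "G = inf (filtercomap f (nhds \<phi>)) F"
  have G: "G \<noteq> bot"
  proof
    assume "G = bot"
    then obtain P Q where P: "eventually P (nhds \<phi>)" and Q: "eventually Q F"
      and PQ: "\<And>n. P (f n) \<Longrightarrow> Q n \<Longrightarrow> False"
      unfolding G_def trivial_limit_def eventually_inf eventually_filtercomap by blast
    have "eventually (\<lambda>g. \<exists>n. g = f n \<and> Q n) (filtermap f F)"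
      using Q by (auto simp: eventually_filtermap elim: eventually_mono)
    then have "eventually (\<lambda>_. False) (inf (nhds \<phi>) (filtermap f F))"
      unfolding eventually_inf using P PQ by blast
    then show False using \<phi> by (simp add: trivial_limit_def)
  qed
  have "filterlim f (nhds \<phi>) G"
    unfolding G_def by (rule filterlim_mono[OF filterlim_filtercomap order_refl]) simp
  then have lim: "((\<lambda>n. inner (x n) z) \<longlongrightarrow> \<phi> z) G" for z
    using continuous_on_tendsto_compose[OF continuous_on_product_coordinates, of f \<phi> G]
    by (simp add: f_def)
  have "bounded_linear \<phi>"
  proof (rule bounded_linear_intro)
    fix z w :: 'a and r :: real
    show "\<phi> (z + w) = \<phi> z + \<phi> w"
      using tendsto_unique[OF G lim[of "z + w"]] tendsto_add[OF lim[of z] lim[of w]]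
      by (simp add: inner_add_right)
    show "\<phi> (r *\<^sub>R z) = r *\<^sub>R \<phi> z"
      using tendsto_unique[OF G lim[of "r *\<^sub>R z"]] tendsto_mult_left[OF lim[of z], of r]
      by simp
    have "\<bar>inner (x n) z\<bar> \<le> C * norm z" for n
      using Cauchy_Schwarz_ineq2[of "x n" z] mult_right_mono[OF C[of n] norm_ge_zero[of z]] by linarith
    then show "norm (\<phi> z) \<le> norm z * C"
      using tendsto_upperbound[OF tendsto_norm[OF lim[of z]] _ G, of "C * norm z"]
      by (simp add: mult.commute)
  qed
  then obtain l where "\<And>z. \<phi> z = inner l z" using riesz_representation by blast
  with lim G show ?thesis unfolding G_def by (metis inf_le2)
qed

text \<open>One vector at a time: passing to a finer filter keeps the limits already
  obtained.\<close>

lemma weak_cluster_finite: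
  fixes x :: "'i \<Rightarrow> 'b \<Rightarrow> 'a::{real_inner,complete_space}"
  assumes "finite I" "F \<noteq> bot" "\<And>i n. i \<in> I \<Longrightarrow> norm (x i n) \<le> C"
  shows "\<exists>G l. G \<le> F \<and> G \<noteq> bot \<and> (\<forall>i\<in>I. \<forall>z. ((\<lambda>n. inner (x i n) z) \<longlongrightarrow> inner (l i) z) G)"
  using assms
proof (induction I rule: finite_induct)
  case empty
  then show ?case by auto
next
  case (insert j I)
  then obtain G l where G: "G \<le> F" "G \<noteq> bot"
    and l: "\<forall>i\<in>I. \<forall>z. ((\<lambda>n. inner (x i n) z) \<longlongrightarrow> inner (l i) z) G" by auto
  obtain H h where H: "H \<le> G" "H \<noteq> bot" and h: "\<forall>z. ((\<lambda>n. inner (x j n) z) \<longlongrightarrow> inner h z) H"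
    using weak_cluster[OF G(2), of "x j" C] insert.prems by auto
  have "\<forall>i\<in>insert j I. \<forall>z. ((\<lambda>n. inner (x i n) z) \<longlongrightarrow> inner ((l(j := h)) i) z) H"
    using h l insert.hyps by (auto intro: tendsto_mono[OF H(1)])
  then show ?case using H G by (metis order_trans)
qed

subsection \<open>Spectral decomposition of finite-rank operators\<close>

text \<open>Bessel's inequality with constant \<open>C\<close>: as a quadratic form,
  \<open>rank_one_sum us\<close> is at most \<open>C\<close> times the identity. Lists allow
  repetition, so that concatenation adds operators.\<close>

definition besselian :: "real \<Rightarrow> 'a::complex_inner list \<Rightarrow> bool" where
  "besselian C us \<longleftrightarrow> (\<forall>z. (\<Sum>u\<leftarrow>us. (cmod (cinner z u))\<^sup>2) \<le> C * (norm z)\<^sup>2)"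

definition orthonormal_set :: "'a::complex_inner set \<Rightarrow> bool" where
  "orthonormal_set E \<longleftrightarrow> (\<forall>e\<in>E. \<forall>f\<in>E. cinner e f = (if e = f then 1 else 0))"

definition rank_one_sum :: "'a::complex_inner list \<Rightarrow> 'a \<Rightarrow> 'a" where
  "rank_one_sum us z = (\<Sum>u\<leftarrow>us. cinner z u *\<^sub>C u)"

lemma cinner_rank_one_sum: "cinner (rank_one_sum us z) w = (\<Sum>u\<leftarrow>us. cinner z u * cnj (cinner w u))"
proof (induction us)
  case (Cons u us)
  then show ?case
    using cinner_commute[of u w] by (simp add: rank_one_sum_def cinner_add_left cinner_scaleC_left)
qed (simp add: rank_one_sum_def)

lemma Re_sum_list: "Re (\<Sum>u\<leftarrow>us. f u) = (\<Sum>u\<leftarrow>us. Re (f u))"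
  by (induction us) auto

lemma of_real_sum_list: "of_real (\<Sum>u\<leftarrow>us. f u) = (\<Sum>u\<leftarrow>us. of_real (f u))"
  by (induction us) auto

lemma cinner_rank_one_sum_self:
  "cinner (rank_one_sum us z) z = of_real (\<Sum>u\<leftarrow>us. (cmod (cinner z u))\<^sup>2)"
  by (simp only: cinner_rank_one_sum of_real_sum_list complex_norm_square)

lemma rank_one_sum_in_span: "rank_one_sum us z \<in> cvec.span (set us)"
proof -
  have "set vs \<subseteq> set us \<Longrightarrow> rank_one_sum vs z \<in> cvec.span (set us)" for vs
    by (induction vs)
      (auto simp: rank_one_sum_def intro: cvec.span_zero cvec.span_add cvec.span_scale cvec.span_base)
  then show ?thesis by blast
qed

lemma cinner_span_eq_0:
  assumes "x \<in> cvec.span S" "\<And>s. s \<in> S \<Longrightarrow> cinner s e = 0"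
  shows "cinner x e = 0"
  using assms(1)
  by (induction rule: cvec.span_induct_alt) (auto simp: assms cinner_add_left cinner_scaleC_left)

text \<open>The quadratic form of a positive finite-rank operator is weakly continuous, so its
  supremum over the unit ball is attained at a weak limit of a maximising sequence, and a maximiser
  is an eigenvector.\<close>

lemma top_eigenvector:
  fixes us :: "'a::chilbert_space list"
  assumes "u0 \<in> set us" "u0 \<noteq> 0"
  obtains e \<mu> where "norm e = 1" "\<mu> > 0" "rank_one_sum us e = \<mu> *\<^sub>R e"
proof -
  define h where "h z = (\<Sum>u\<leftarrow>us. (cmod (cinner z u))\<^sup>2)" for z
  have h_nonneg: "h z \<ge> 0" for z unfolding h_def by (rule sum_list_nonneg) auto
  have h_scale: "h (r *\<^sub>R z) = r\<^sup>2 * h z" for r z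
    by (simp add: h_def norm_mult power_mult_distrib sum_list_const_mult)
  define B where "B = h ` cball 0 1"
  have h_bdd: "h z \<le> (\<Sum>u\<leftarrow>us. (norm u)\<^sup>2)" if "norm z \<le> 1" for z
    unfolding h_def
  proof (rule sum_list_mono)
    fix u
    have "cmod (cinner z u) \<le> norm u"
      using cinner_cauchy_schwarz[of z u] mult_right_mono[OF that norm_ge_zero[of u]] by simp
    then show "(cmod (cinner z u))\<^sup>2 \<le> (norm u)\<^sup>2" by simp
  qed
  then have bdd: "bdd_above B" by (auto simp: B_def intro!: bdd_aboveI2)
  define \<mu> where "\<mu> = Sup B"
  have h_le1: "h z \<le> \<mu>" if "norm z \<le> 1" for z
    unfolding \<mu>_def by (rule cSup_upper) (use bdd that in \<open>auto simp: B_def\<close>)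
  have h_le: "h z \<le> \<mu> * (norm z)\<^sup>2" for z
  proof (cases "z = 0")
    case False
    then have "h z = (norm z)\<^sup>2 * h ((1 / norm z) *\<^sub>R z)"
      by (simp add: h_scale field_simps)
    also have "\<dots> \<le> (norm z)\<^sup>2 * \<mu>" by (intro mult_left_mono h_le1) (use False in auto)
    finally show ?thesis by (simp add: mult.commute)
  qed (simp add: h_def)
  have "0 < (cmod (cinner u0 u0))\<^sup>2" using assms by (simp add: cinner_self)
  also have "\<dots> \<le> h u0" unfolding h_def
    by (rule member_le_sum_list) (use assms(1) in auto)
  also have "\<dots> \<le> \<mu> * (norm u0)\<^sup>2" by (rule h_le)
  finally have \<mu>_pos: "\<mu> > 0" using assms(2) by (simp add: zero_less_mult_iff)
  have "\<exists>z. norm z \<le> 1 \<and> \<mu> - 1 / Suc n < h z" for n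
  proof -
    have "\<mu> - 1 / Suc n < Sup B" by (simp add: \<mu>_def)
    moreover have "B \<noteq> {}" by (auto simp: B_def)
    ultimately obtain b where "b \<in> B" "\<mu> - 1 / Suc n < b" by (meson less_cSupD)
    then show ?thesis by (auto simp: B_def)
  qed
  then obtain s where s: "\<And>n. norm (s n) \<le> 1" "\<And>n. \<mu> - 1 / Suc n < h (s n)" by metis
  obtain G e where G: "G \<le> sequentially" "G \<noteq> bot"
    and lim: "\<And>z. ((\<lambda>n. inner (s n) z) \<longlongrightarrow> inner e z) G"
    using weak_cluster[OF sequentially_bot, of s 1] s(1) by auto
  have "((\<lambda>n. h (s n)) \<longlongrightarrow> h e) G"
    unfolding h_def
    by (induction us) (auto intro!: tendsto_intros tendsto_cinner_left lim)
  moreover have "((\<lambda>n. \<mu> - 1 / Suc n) \<longlongrightarrow> \<mu> - 0) G"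
    by (rule tendsto_mono[OF G(1)]) (intro tendsto_intros LIMSEQ_Suc[OF lim_1_over_n])
  ultimately have "\<mu> \<le> h e"
    using tendsto_le[OF G(2), of "\<lambda>n. h (s n)" "h e" "\<lambda>n. \<mu> - 1 / Suc n" "\<mu> - 0"] s(2)
    by (simp add: less_imp_le)
  have "(norm e)\<^sup>2 \<le> norm e"
  proof -
    have "inner (s n) e \<le> norm e" for n
      using norm_cauchy_schwarz[of "s n" e] mult_right_mono[OF s(1)[of n] norm_ge_zero[of e]] by simp
    then show ?thesis
      using tendsto_upperbound[OF lim[of e] _ G(2), of "norm e"] by (simp add: power2_norm_eq_inner)
  qed
  then have e_le: "norm e \<le> 1"
    by (cases "norm e = 0") (auto simp: power2_eq_square)
  have he: "h e = \<mu>" using h_le1[OF e_le] \<open>\<mu> \<le> h e\<close> by simp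
  \<comment> \<open>A weak limit of points of the ball could have norm below 1; homogeneity of
    \<open>h\<close> and \<open>\<mu> > 0\<close> rule this out.\<close>
  then have "\<mu> * 1 \<le> \<mu> * (norm e)\<^sup>2" using h_le[of e] by simp
  then have "1 \<le> (norm e)\<^sup>2" using \<mu>_pos by simp
  then have e1: "norm e = 1" using e_le
    by (smt (verit) norm_ge_zero power_le_one power2_eq_1_iff)
  \<comment> \<open>The function \<open>\<mu> * (norm w)\<^sup>2 - h w\<close> is nonnegative and
    vanishes at \<open>w = e\<close>, so its first variation there is zero.\<close>
  have "inner (\<mu> *\<^sub>R e - rank_one_sum us e) z = 0" for z
  proof (rule linear_coeff_zero_if_quadratic_nonneg)
    fix t :: real
    have "(cmod (cinner (e + t *\<^sub>R z) u))\<^sup>2 = (cmod (cinner e u))\<^sup>2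
        + 2 * t * Re (cinner e u * cnj (cinner z u)) + t\<^sup>2 * (cmod (cinner z u))\<^sup>2" for u
      unfolding cmod_power2 by (simp add: cinner_add_left power2_eq_square algebra_simps)
    then have "h (e + t *\<^sub>R z) = h e + 2 * t * inner (rank_one_sum us e) z + t\<^sup>2 * h z"
      by (simp add: h_def Re_cinner[symmetric] cinner_rank_one_sum Re_sum_list sum_list_addf
          sum_list_const_mult)
    moreover have "(norm (e + t *\<^sub>R z))\<^sup>2 = 1 + 2 * t * inner e z + t\<^sup>2 * (norm z)\<^sup>2"
      using e1 by (simp add: power2_norm_eq_inner inner_add_left inner_add_right inner_commute
          power2_eq_square[of t] norm_eq_1)
    ultimately have "\<mu> + 2 * t * inner (rank_one_sum us e) z + t\<^sup>2 * h z
        \<le> \<mu> * (1 + 2 * t * inner e z + t\<^sup>2 * (norm z)\<^sup>2)"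
      using h_le[of "e + t *\<^sub>R z"] he by simp
    then show "0 \<le> 2 * t * inner (\<mu> *\<^sub>R e - rank_one_sum us e) z + t\<^sup>2 * (\<mu> * (norm z)\<^sup>2 - h z)"
      by (simp add: inner_diff_left algebra_simps)
  qed
  then have "rank_one_sum us e = \<mu> *\<^sub>R e"
    by (metis inner_eq_zero_iff eq_iff_diff_eq_0)
  with e1 \<mu>_pos show thesis by (rule that)
qed

section \<open>Self-adjoint forms and deflation by an eigenvector\<close>

lemma selfadjoint_opD:
  assumes "selfadjoint_op T"
  shows "bounded_linear T" "T (c *\<^sub>C x) = c *\<^sub>C T x" "cinner (T x) y = cinner x (T y)"
  using assms by (auto simp: selfadjoint_op_def bounded_clinear_def)

lemma selfadjoint_op_id: "selfadjoint_op (\<lambda>x. x)"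
  by (simp add: selfadjoint_op_def bounded_clinear_def bounded_linear_ident)

lemma selfadjoint_expand:
  assumes T: "selfadjoint_op T"
  shows "inner (T (x + c *\<^sub>C y)) (x + c *\<^sub>C y)
    = inner (T x) x + 2 * Re (c * cinner (T y) x) + (cmod c)\<^sup>2 * inner (T y) y"
proof -
  have add: "T (x + z) = T x + T z" for z
    using selfadjoint_opD(1)[OF T] by (simp add: linear_simps(1))
  have "cinner (T x) y = cnj (cinner (T y) x)"
    by (metis cinner_commute selfadjoint_opD(3)[OF T])
  then have "cinner (T (x + c *\<^sub>C y)) (x + c *\<^sub>C y)
    = cinner (T x) x + (cnj (c * cinner (T y) x) + c * cinner (T y) x)
      + (c * cnj c) * cinner (T y) y"
    by (simp add: add selfadjoint_opD(2)[OF T] cinner_add_left cinner_add_right cinner_scaleC_left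
        cinner_scaleC_right algebra_simps)
  moreover have "Re ((c * cnj c) * cinner (T y) y) = (cmod c)\<^sup>2 * inner (T y) y"
    by (simp only: complex_norm_square[symmetric] Re_cinner[symmetric] Re_complex_of_real
        times_complex.sel Im_complex_of_real mult_zero_left diff_0_right flip: of_real_power)
  ultimately show ?thesis by (simp add: Re_cinner[symmetric])
qed

text \<open>Since \<open>e\<close> is an eigenvector of \<open>rank_one_sum us\<close>, the cross terms cancel in the sum.\<close>

lemma deflate_quadratic:
  assumes T: "selfadjoint_op T" and e: "norm e = 1" and eig: "rank_one_sum us e = \<mu> *\<^sub>R e"
  shows "(\<Sum>u\<leftarrow>us. inner (T u) u) = \<mu> * inner (T e) e
    + (\<Sum>u\<leftarrow>map (\<lambda>u. u - cinner u e *\<^sub>C e) us. inner (T u) u)"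
proof -
  define r where "r u = u - cinner u e *\<^sub>C e" for u
  have c: "cinner e u * cinner u e = of_real ((cmod (cinner e u))\<^sup>2)" for u
    by (metis cinner_commute complex_norm_square)
  have "of_real \<mu> = cinner (rank_one_sum us e) e"
    by (simp add: eig cinner_self e)
  then have \<mu>: "(\<Sum>u\<leftarrow>us. (cmod (cinner e u))\<^sup>2) = \<mu>"
    by (simp only: cinner_rank_one_sum_self of_real_eq_iff)
  have "(\<Sum>u\<leftarrow>us. cinner e u *\<^sub>C r u)
      = rank_one_sum us e - (\<Sum>u\<leftarrow>us. (cmod (cinner e u))\<^sup>2) *\<^sub>R e"
  proof -
    have "cinner e u *\<^sub>C r u = cinner e u *\<^sub>C u - (cmod (cinner e u))\<^sup>2 *\<^sub>R e" for u
      by (simp add: r_def cvec.scale_right_diff_distrib scaleC_scaleC c scaleC_of_real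
          del: of_real_power)
    then show ?thesis
      by (induction us) (simp_all add: rank_one_sum_def scaleR_add_left)
  qed
  then have zero: "(\<Sum>u\<leftarrow>us. cinner e u *\<^sub>C r u) = 0" by (simp add: \<mu> eig)
  have cnj: "cnj (cinner e u) = cinner u e" for u by (metis cinner_commute)
  have cross: "(\<Sum>u\<leftarrow>us. cinner u e * cinner (T e) (r u)) = 0"
  proof -
    have "(\<Sum>u\<leftarrow>us. cinner u e * cinner (T e) (r u)) = cinner (T e) (\<Sum>u\<leftarrow>us. cinner e u *\<^sub>C r u)"
      by (simp add: cinner_sum_list_right cinner_scaleC_right cnj)
    then show ?thesis by (simp add: zero)
  qed
  have expand: "inner (T u) u = inner (T (r u)) (r u) + 2 * Re (cinner u e * cinner (T e) (r u))
      + (cmod (cinner e u))\<^sup>2 * inner (T e) e" for u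
  proof -
    have "cmod (cinner u e) = cmod (cinner e u)" by (metis cnj complex_mod_cnj)
    then show ?thesis
      using selfadjoint_expand[OF T, of "r u" "cinner u e" e] by (simp add: r_def)
  qed
  have "(\<Sum>u\<leftarrow>us. inner (T u) u) = (\<Sum>u\<leftarrow>us. inner (T (r u)) (r u))
      + 2 * Re (\<Sum>u\<leftarrow>us. cinner u e * cinner (T e) (r u))
      + (\<Sum>u\<leftarrow>us. (cmod (cinner e u))\<^sup>2) * inner (T e) e"
  proof (induction us)
    case (Cons u us)
    then show ?case using expand[of u] by (simp add: algebra_simps)
  qed simp
  then show ?thesis by (simp only: cross \<mu>) (simp add: r_def o_def)
qed

text \<open>Adjoining \<open>e\<close> to a basis of \<open>S'\<close> keeps it independent inside
  the span of \<open>S\<close>. This makes the dimension a termination measure for the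
  deflation.\<close>

lemma cdim_psubset:
  fixes S S' :: "'a::complex_inner set"
  assumes fin: "finite S" "finite S'" and sub: "S' \<subseteq> cvec.span S"
    and e: "e \<in> cvec.span S" "e \<notin> cvec.span S'"
  shows "cvec.dim S' < cvec.dim S"
proof -
  obtain B where B: "B \<subseteq> S'" "cvec.independent B" "S' \<subseteq> cvec.span B" "card B = cvec.dim S'"
    by (rule cvec.basis_exists)
  have spanB: "cvec.span B = cvec.span S'"
    using B by (simp add: cvec.span_eq subset_trans[OF B(1) cvec.span_superset])
  have ind: "cvec.independent (insert e B)" "e \<notin> B"
    using e B(2) spanB cvec.span_base by (auto simp: cvec.independent_insert)
  obtain C where C: "C \<subseteq> S" "cvec.independent C" "S \<subseteq> cvec.span C" "card C = cvec.dim S"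
    by (rule cvec.basis_exists)
  have "cvec.span S \<subseteq> cvec.span C" by (metis C(3) cvec.span_minimal cvec.subspace_span)
  then have "insert e B \<subseteq> cvec.span C" using e B(1) sub by blast
  then have "card (insert e B) \<le> card C"
    using cvec.independent_span_bound[OF finite_subset[OF C(1) fin(1)] ind(1)] by blast
  then show ?thesis using B C ind(2) finite_subset[OF B(1) fin(2)] by simp
qed

text \<open>The projection onto the complement of \<open>e\<close> can be moved from the list to
  \<open>z\<close>, and projecting \<open>z\<close> only shortens it.\<close>

lemma besselian_deflate:
  assumes "besselian C us" "norm e = 1" "C \<ge> 0"
  shows "besselian C (map (\<lambda>u. u - cinner u e *\<^sub>C e) us)"
  unfolding besselian_def
proof
  fix z
  define z' where "z' = z - cinner z e *\<^sub>C e"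
  have "cinner z (u - cinner u e *\<^sub>C e) = cinner z' u" for u
    using cinner_commute[of e u] by (simp add: z'_def cinner_diff_left cinner_diff_right cinner_scaleC_left
        cinner_scaleC_right)
  then have "(\<Sum>u\<leftarrow>map (\<lambda>u. u - cinner u e *\<^sub>C e) us. (cmod (cinner z u))\<^sup>2) \<le> C * (norm z')\<^sup>2"
    using assms(1) by (simp add: besselian_def o_def)
  moreover have "(norm z)\<^sup>2 = (norm z')\<^sup>2 + (norm (cinner z e *\<^sub>C e))\<^sup>2"
    using norm_add_orthogonal[of z' "cinner z e *\<^sub>C e"] assms(2)
    by (simp add: z'_def cinner_diff_left cinner_scaleC_left cinner_scaleC_right cinner_self)
  then have "C * (norm z')\<^sup>2 \<le> C * (norm z)\<^sup>2" using assms(3) by (simp add: mult_left_mono)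
  ultimately show "(\<Sum>u\<leftarrow>map (\<lambda>u. u - cinner u e *\<^sub>C e) us. (cmod (cinner z u))\<^sup>2) \<le> C * (norm z)\<^sup>2"
    by linarith
qed

text \<open>Split off a top eigenvector, project the list onto its orthogonal complement and induct
  on the dimension of the span. The decomposition is recorded only through traces against
  self-adjoint operators, which gives both the values and the total mass.\<close>

lemma spectral_decomposition:
  fixes us :: "'a::chilbert_space list"
  assumes "besselian C us" "C \<ge> 0"
  shows "\<exists>E d. finite E \<and> orthonormal_set E \<and> E \<subseteq> cvec.span (set us)
    \<and> (\<forall>e\<in>E. 0 \<le> d e \<and> d e \<le> C)
    \<and> (\<forall>T. selfadjoint_op T \<longrightarrow> (\<Sum>u\<leftarrow>us. inner (T u) u) = (\<Sum>e\<in>E. d e * inner (T e) e))"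
  using assms(1)
proof (induction "cvec.dim (set us)" arbitrary: us rule: less_induct)
  case less
  show ?case
  proof (cases "\<forall>u\<in>set us. u = 0")
    case True
    then have "(\<Sum>u\<leftarrow>us. inner (T u) u) = 0" for T :: "'a \<Rightarrow> 'a"
      by (induction us) auto
    then show ?thesis by (intro exI[of _ "{}"]) (auto simp: orthonormal_set_def)
  next
    case False
    then obtain u0 where "u0 \<in> set us" "u0 \<noteq> 0" by blast
    then obtain e \<mu> where e: "norm e = 1" and \<mu>: "\<mu> > 0" and eig: "rank_one_sum us e = \<mu> *\<^sub>R e"
      by (rule top_eigenvector)
    define us' where "us' = map (\<lambda>u. u - cinner u e *\<^sub>C e) us"
    have ee: "cinner e e = 1" by (simp add: cinner_self e)
    have "\<mu> *\<^sub>R e \<in> cvec.span (set us)" using rank_one_sum_in_span[of us e] eig by simp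
    then have "of_real (1 / \<mu>) *\<^sub>C (\<mu> *\<^sub>R e) \<in> cvec.span (set us)" by (rule cvec.span_scale)
    then have e_span: "e \<in> cvec.span (set us)" using \<mu> by (simp add: scaleC_of_real del: of_real_divide)
    have sub: "set us' \<subseteq> cvec.span (set us)"
      by (auto simp: us'_def intro: cvec.span_diff[OF cvec.span_base cvec.span_scale[OF e_span]])
    have "cinner u e = 0" if "u \<in> set us'" for u
      using that by (auto simp: us'_def cinner_diff_left cinner_scaleC_left ee)
    then have perp: "cinner x e = 0" if "x \<in> cvec.span (set us')" for x
      using cinner_span_eq_0[OF that] by blast
    have e_notin: "e \<notin> cvec.span (set us')" using perp[of e] ee by auto
    then have "cvec.dim (set us') < cvec.dim (set us)"
      using cdim_psubset[OF _ _ sub e_span] by simp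
    moreover have "besselian C us'"
      unfolding us'_def by (rule besselian_deflate[OF less.prems e assms(2)])
    ultimately obtain E d where E: "finite E" "orthonormal_set E" "E \<subseteq> cvec.span (set us')"
      and d: "\<forall>f\<in>E. 0 \<le> d f \<and> d f \<le> C"
      and val: "\<And>T. selfadjoint_op T \<Longrightarrow> (\<Sum>u\<leftarrow>us'. inner (T u) u) = (\<Sum>f\<in>E. d f * inner (T f) f)"
      using less.hyps by blast
    have eE: "e \<notin> E" using e_notin E(3) by blast
    have fe: "cinner f e = 0" if "f \<in> E" for f using perp E(3) that by blast
    have "of_real \<mu> = cinner (rank_one_sum us e) e" by (simp add: eig ee)
    then have "\<mu> = (\<Sum>u\<leftarrow>us. (cmod (cinner e u))\<^sup>2)"
      by (simp only: cinner_rank_one_sum_self of_real_eq_iff)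
    also have "\<dots> \<le> C" using less.prems[unfolded besselian_def, rule_format, of e] e by simp
    finally have "\<mu> \<le> C" .
    show ?thesis
    proof (intro exI[of _ "insert e E"] exI[of _ "d(e := \<mu>)"] conjI allI impI)
      show "finite (insert e E)" using E by simp
      show "orthonormal_set (insert e E)"
        using E(2) eE ee fe cinner_eq_zero_commute[of e] by (auto simp: orthonormal_set_def)
      show "insert e E \<subseteq> cvec.span (set us)"
        using E(3) e_span cvec.span_minimal[OF sub cvec.subspace_span] by blast
      show "\<forall>f\<in>insert e E. 0 \<le> (d(e := \<mu>)) f \<and> (d(e := \<mu>)) f \<le> C"
        using d \<mu> \<open>\<mu> \<le> C\<close> by auto
      fix T :: "'a \<Rightarrow> 'a" assume T: "selfadjoint_op T"
      have "(\<Sum>f\<in>E. (d(e := \<mu>)) f * inner (T f) f) = (\<Sum>f\<in>E. d f * inner (T f) f)"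
        by (rule sum.cong) (use eE in auto)
      then show "(\<Sum>u\<leftarrow>us. inner (T u) u) = (\<Sum>f\<in>insert e E. (d(e := \<mu>)) f * inner (T f) f)"
        using deflate_quadratic[OF T e eig] val[OF T] E(1) eE by (simp add: us'_def)
    qed
  qed
qed

subsection \<open>The convex hull of the range\<close>

text \<open>\<open>x\<close> is not normalised: its squared length acts as the weight of the
  rank-one operator it stands for.\<close>

definition qval :: "('m::finite \<Rightarrow> 'a::complex_inner \<Rightarrow> 'a) \<Rightarrow> 'a \<Rightarrow> real ^ 'm" where
  "qval A x = (\<chi> j. inner (A j x) x)"

definition real_num_range :: "nat \<Rightarrow> ('m::finite \<Rightarrow> 'a::complex_inner \<Rightarrow> 'a) \<Rightarrow> (real ^ 'm) set" where
  "real_num_range k A = {(\<Sum>l=1..k. qval A (x l)) | x. corthonormal k x}"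

text \<open>
  A list \<open>us\<close> encodes the positive finite-rank operator \<open>D = rank_one_sum us\<close>; then \<open>besselian 1 us\<close>
  means \<open>D \<le> I\<close>, and the two sums below are \<open>(tr (A\<^sub>j D))\<^sub>j\<close> and \<open>tr D\<close>.
\<close>

definition ensemble_range :: "nat \<Rightarrow> ('m::finite \<Rightarrow> 'a::complex_inner \<Rightarrow> 'a) \<Rightarrow> (real ^ 'm) set" where
  "ensemble_range k A =
    {(\<Sum>u\<leftarrow>us. qval A u) | us. besselian 1 us \<and> (\<Sum>u\<leftarrow>us. (norm u)\<^sup>2) = real k}"

lemma ensemble_rangeI:
  assumes "besselian 1 us" "(\<Sum>u\<leftarrow>us. (norm u)\<^sup>2) = real k" "p = (\<Sum>u\<leftarrow>us. qval A u)"
  shows "p \<in> ensemble_range k A"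
  using assms unfolding ensemble_range_def by blast

section \<open>Scaling and joining lists of vectors\<close>

lemma besselian_scale:
  assumes "besselian C us"
  shows "besselian (r\<^sup>2 * C) (map (\<lambda>u. r *\<^sub>R u) us)"
proof -
  have "(\<Sum>u\<leftarrow>us. \<bar>r\<bar>\<^sup>2 * (cmod (cinner z u))\<^sup>2) \<le> r\<^sup>2 * C * (norm z)\<^sup>2" for z
    using assms mult_left_mono[of _ _ "r\<^sup>2"]
    by (simp add: besselian_def sum_list_const_mult mult.assoc)
  then show ?thesis
    by (simp add: besselian_def o_def norm_mult power_mult_distrib)
qed

lemma besselian_append:
  assumes "besselian C us" "besselian D vs"
  shows "besselian (C + D) (us @ vs)"
  using assms by (auto simp: besselian_def distrib_right intro: add_mono)

lemma besselian_mono: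
  assumes "besselian C us" "C \<le> D"
  shows "besselian D us"
  using assms(1) mult_right_mono[OF assms(2) zero_le_power2]
  unfolding besselian_def by (blast intro: order_trans)

text \<open>Pair \<open>D z\<close> with itself, where \<open>D = rank_one_sum us\<close>, bound
  each product by weighted AM-GM and absorb half of the result by the Bessel bound. In operator
  terms, \<open>D\<^sup>2 \<le> C D\<close>.\<close>

lemma norm_rank_one_sum:
  assumes "besselian C us" "C > 0"
  shows "(norm (rank_one_sum us z))\<^sup>2 \<le> C * (\<Sum>u\<leftarrow>us. (cmod (cinner z u))\<^sup>2)"
proof -
  define w where "w = rank_one_sum us z"
  have "2 * (x * y) \<le> C * x\<^sup>2 + y\<^sup>2 / C" for x y :: real
  proof -
    have "0 \<le> (C * x - y)\<^sup>2 / C" using assms(2) by simp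
    also have "\<dots> = C * x\<^sup>2 + y\<^sup>2 / C - 2 * (x * y)"
      using assms(2) by (simp add: field_simps power2_eq_square)
    finally show ?thesis by simp
  qed
  then have pt: "2 * Re (cinner z u * cnj (cinner w u))
      \<le> C * (cmod (cinner z u))\<^sup>2 + (cmod (cinner w u))\<^sup>2 / C" for u
    using complex_Re_le_cmod[of "cinner z u * cnj (cinner w u)"]
    by (smt (verit) complex_mod_cnj norm_mult)
  have "2 * (norm w)\<^sup>2 = (\<Sum>u\<leftarrow>us. 2 * Re (cinner z u * cnj (cinner w u)))"
    using arg_cong[OF cinner_rank_one_sum[of us z w], of Re]
    by (simp only: w_def[symmetric] cinner_self Re_sum_list sum_list_const_mult Re_complex_of_real)
  also have "\<dots> \<le> (\<Sum>u\<leftarrow>us. C * (cmod (cinner z u))\<^sup>2 + (cmod (cinner w u))\<^sup>2 / C)"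
    by (rule sum_list_mono) (rule pt)
  also have "\<dots> = C * (\<Sum>u\<leftarrow>us. (cmod (cinner z u))\<^sup>2) + (\<Sum>u\<leftarrow>us. (cmod (cinner w u))\<^sup>2) / C"
    by (simp add: sum_list_addf sum_list_const_mult divide_inverse sum_list_mult_const)
  also have "(\<Sum>u\<leftarrow>us. (cmod (cinner w u))\<^sup>2) / C \<le> (norm w)\<^sup>2"
    using assms by (simp add: besselian_def pos_divide_le_eq mult.commute)
  finally show ?thesis by (simp add: w_def)
qed

text \<open>The two operators have orthogonal images, so \<open>D\<^sup>2 \<le> C D\<close> passes
  to their sum \<open>D\<close> and forces \<open>D \<le> C\<close>. Without orthogonality the
  bounds may add.\<close>

lemma besselian_append_orthogonal:
  assumes us: "besselian C us" and vs: "besselian C vs" and C: "C > 0"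
    and orth: "\<And>u v. u \<in> set us \<Longrightarrow> v \<in> set vs \<Longrightarrow> cinner u v = 0"
  shows "besselian C (us @ vs)"
  unfolding besselian_def
proof
  fix z
  define a b where "a = rank_one_sum us z" and "b = rank_one_sum vs z"
  define s where "s = (\<Sum>u\<leftarrow>us @ vs. (cmod (cinner z u))\<^sup>2)"
  have "cinner u b = 0" if "u \<in> set us" for u
    using cinner_span_eq_0[OF rank_one_sum_in_span, of vs u z] orth[OF that]
    by (simp add: b_def cinner_eq_zero_commute)
  then have "cinner a b = 0"
    using cinner_span_eq_0[OF rank_one_sum_in_span, of us b z] by (simp add: a_def)
  then have "(norm (a + b))\<^sup>2 = (norm a)\<^sup>2 + (norm b)\<^sup>2" by (rule norm_add_orthogonal)
  then have ab: "(norm (a + b))\<^sup>2 \<le> C * s"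
    using norm_rank_one_sum[OF us C, of z] norm_rank_one_sum[OF vs C, of z]
    by (simp add: a_def b_def s_def distrib_left)
  have "cinner (a + b) z = of_real s"
    by (simp add: a_def b_def s_def cinner_add_left cinner_rank_one_sum_self)
  then have "s = inner (a + b) z" by (simp add: Re_cinner[symmetric])
  then have "0 \<le> (norm (a + b))\<^sup>2 - 2 * C * s + C\<^sup>2 * (norm z)\<^sup>2"
    using zero_le_power2[of "norm (a + b - C *\<^sub>R z)"]
    by (simp only: power2_norm_eq_inner inner_diff_left inner_diff_right inner_commute)
      (simp add: inner_commute power2_eq_square algebra_simps)
  then have "C * s \<le> C * (C * (norm z)\<^sup>2)" using ab by (simp add: power2_eq_square)
  then show "s \<le> C * (norm z)\<^sup>2" using C by simp
qed

lemma qval_scaleR: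
  assumes "\<And>j. selfadjoint_op (A j)"
  shows "qval A (r *\<^sub>R x) = r\<^sup>2 *\<^sub>R qval A x"
  using selfadjoint_opD(1)[OF assms]
  by (simp add: qval_def vec_eq_iff linear_simps(5) power2_eq_square)

lemma sum_list_qval_scaleR:
  assumes "\<And>j. selfadjoint_op (A j)"
  shows "(\<Sum>u\<leftarrow>map (\<lambda>u. r *\<^sub>R u) us. qval A u) = r\<^sup>2 *\<^sub>R (\<Sum>u\<leftarrow>us. qval A u)"
  by (induction us) (simp_all add: qval_scaleR[OF assms] scaleR_add_right)

lemma sum_list_norm_scaleR:
  "(\<Sum>u\<leftarrow>map (\<lambda>u. r *\<^sub>R u) us. (norm u)\<^sup>2) = r\<^sup>2 * (\<Sum>u\<leftarrow>us. (norm u)\<^sup>2)"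
  by (induction us) (simp_all add: power_mult_distrib distrib_left)

text \<open>Scaling vectors by \<open>sqrt s\<close> multiplies their operator by \<open>s\<close>,
  so concatenating two scaled lists forms a convex combination of operators.\<close>

lemma convex_ensemble_range:
  assumes A: "\<And>j. selfadjoint_op (A j)"
  shows "convex (ensemble_range k A)"
proof (rule convexI)
  fix p q and s t :: real
  assume "p \<in> ensemble_range k A" "q \<in> ensemble_range k A" and st: "0 \<le> s" "0 \<le> t" "s + t = 1"
  then obtain us vs where us: "besselian 1 us" "(\<Sum>u\<leftarrow>us. (norm u)\<^sup>2) = real k" "p = (\<Sum>u\<leftarrow>us. qval A u)"
    and vs: "besselian 1 vs" "(\<Sum>u\<leftarrow>vs. (norm u)\<^sup>2) = real k" "q = (\<Sum>u\<leftarrow>vs. qval A u)"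
    unfolding ensemble_range_def by blast
  show "s *\<^sub>R p + t *\<^sub>R q \<in> ensemble_range k A"
  proof (rule ensemble_rangeI)
    show "besselian 1 (map (\<lambda>u. sqrt s *\<^sub>R u) us @ map (\<lambda>u. sqrt t *\<^sub>R u) vs)"
      using besselian_append[OF besselian_scale[OF us(1), of "sqrt s"] besselian_scale[OF vs(1), of "sqrt t"]] st
      by simp
    show "(\<Sum>u\<leftarrow>map (\<lambda>u. sqrt s *\<^sub>R u) us @ map (\<lambda>u. sqrt t *\<^sub>R u) vs. (norm u)\<^sup>2) = real k"
      using st by (simp only: map_append sum_list_append sum_list_norm_scaleR us vs)
        (simp flip: distrib_right)
    show "s *\<^sub>R p + t *\<^sub>R q
        = (\<Sum>u\<leftarrow>map (\<lambda>u. sqrt s *\<^sub>R u) us @ map (\<lambda>u. sqrt t *\<^sub>R u) vs. qval A u)"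
      using st by (simp only: map_append sum_list_append sum_list_qval_scaleR[OF A] us vs) simp
  qed
qed

lemma sum_list_map_upt: "(\<Sum>u\<leftarrow>map x [1..<Suc k]. f u) = (\<Sum>l=1..k. f (x l))"
  by (simp add: interv_sum_list_conv_sum_set_nat atLeastLessThanSuc_atLeastAtMost o_def del: upt_Suc)

lemma norm_corthonormal:
  assumes "corthonormal k x" "l \<in> {1..k}"
  shows "norm (x l) = 1"
proof -
  have "of_real ((norm (x l))\<^sup>2) = (1 :: complex)"
    using assms cinner_self[of "x l"] by (simp add: corthonormal_def)
  then show ?thesis by (simp only: of_real_eq_1_iff power2_eq_1_iff) (smt (verit) norm_ge_zero)
qed

text \<open>Bessel's inequality, obtained by adjoining one unit vector at a time
  orthogonally.\<close>

lemma besselian_corthonormal: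
  assumes x: "corthonormal k x"
  shows "besselian 1 (map x [1..<Suc k])"
proof -
  have "besselian 1 (map x [1..<Suc n])" if "n \<le> k" for n
    using that
  proof (induction n)
    case (Suc n)
    have "besselian 1 [x (Suc n)]"
      using cinner_cauchy_schwarz[of _ "x (Suc n)"] norm_corthonormal[OF x, of "Suc n"] Suc.prems
      by (auto simp: besselian_def intro!: power_mono)
    moreover have "cinner (x i) (x (Suc n)) = 0" if "i \<in> {1..<Suc n}" for i
      using x that Suc.prems by (auto simp: corthonormal_def)
    ultimately have "besselian 1 (map x [1..<Suc n] @ [x (Suc n)])"
      using Suc by (intro besselian_append_orthogonal) (auto simp del: upt_Suc)
    then show ?case by simp
  qed (simp add: besselian_def)
  then show ?thesis by simp
qed

lemma real_num_range_subset_ensemble: "real_num_range k A \<subseteq> ensemble_range k A"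
proof
  fix p assume "p \<in> real_num_range k A"
  then obtain x where x: "corthonormal k x" and p: "p = (\<Sum>l=1..k. qval A (x l))"
    unfolding real_num_range_def by blast
  have "(\<Sum>l=1..k. (norm (x l))\<^sup>2) = (\<Sum>l=1..k. 1)"
    by (rule sum.cong) (simp_all add: norm_corthonormal[OF x])
  then show "p \<in> ensemble_range k A"
    by (intro ensemble_rangeI[OF besselian_corthonormal[OF x]])
      (simp_all only: sum_list_map_upt p, simp)
qed

text \<open>Testing the spectral decomposition against each \<open>A j\<close> gives the value,
  against the identity the trace.\<close>

lemma ensemble_range_spectral:
  fixes A :: "'m::finite \<Rightarrow> 'a::chilbert_space \<Rightarrow> 'a"
  assumes A: "\<And>j. selfadjoint_op (A j)" and p: "p \<in> ensemble_range k A"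
  obtains E d where "finite E" "orthonormal_set E" "\<forall>e\<in>E. 0 \<le> d e \<and> d e \<le> 1"
    "(\<Sum>e\<in>E. d e) = real k" "p = (\<Sum>e\<in>E. d e *\<^sub>R qval A e)"
proof -
  obtain us where us: "besselian 1 us" "(\<Sum>u\<leftarrow>us. (norm u)\<^sup>2) = real k" "p = (\<Sum>u\<leftarrow>us. qval A u)"
    using p unfolding ensemble_range_def by blast
  obtain E d where E: "finite E" "orthonormal_set E" "\<forall>e\<in>E. 0 \<le> d e \<and> d e \<le> 1"
    and val: "\<And>T. selfadjoint_op T \<Longrightarrow> (\<Sum>u\<leftarrow>us. inner (T u) u) = (\<Sum>e\<in>E. d e * inner (T e) e)"
    using spectral_decomposition[OF us(1)] by auto
  have "inner e e = 1" if "e \<in> E" for e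
    using E(2) that by (simp add: orthonormal_set_def Re_cinner[symmetric])
  then have "(\<Sum>e\<in>E. d e) = real k"
    using val[OF selfadjoint_op_id] us(2) by (simp add: power2_norm_eq_inner)
  moreover have "(\<Sum>u\<leftarrow>us. qval A u) $ j = (\<Sum>u\<leftarrow>us. inner (A j u) u)" for j
    by (induction us) (simp_all add: qval_def)
  then have "p = (\<Sum>e\<in>E. d e *\<^sub>R qval A e)"
    by (simp add: us(3) vec_eq_iff val[OF A]) (simp add: qval_def)
  ultimately show thesis using that E by blast
qed

section \<open>Weights in the unit interval with integer sum\<close>

lemma sum_fractional:
  assumes "finite E" "\<And>e. e \<in> E \<Longrightarrow> d e = 0 \<or> d e = (1::real)"
  shows "(\<Sum>e\<in>E. d e *\<^sub>R (f e :: 'v::real_vector)) = (\<Sum>e\<in>{e \<in> E. d e = 1}. f e)"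
  using assms by (intro sum.mono_neutral_cong_right) auto

text \<open>If \<open>d a\<close> were the only fractional weight, the total would lie strictly
  between consecutive integers.\<close>

lemma another_fractional:
  fixes d :: "'b \<Rightarrow> real"
  assumes E: "finite E" "\<And>e. e \<in> E \<Longrightarrow> 0 \<le> d e \<and> d e \<le> 1" "(\<Sum>e\<in>E. d e) = real k"
    and a: "a \<in> E" "0 < d a" "d a < 1"
  shows "\<exists>b\<in>E. b \<noteq> a \<and> 0 < d b \<and> d b < 1"
proof (rule ccontr)
  assume "\<not> ?thesis"
  then have "d e = 0 \<or> d e = 1" if "e \<in> E - {a}" for e using E(2)[of e] that by force
  then have "(\<Sum>e\<in>E - {a}. d e *\<^sub>R (1::real)) = (\<Sum>e\<in>{e \<in> E - {a}. d e = 1}. 1)"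
    using E(1) by (intro sum_fractional) auto
  then have "(\<Sum>e\<in>E - {a}. d e) = real (card {e \<in> E - {a}. d e = 1})" by simp
  then have k: "real k = d a + real (card {e \<in> E - {a}. d e = 1})"
    using E sum.remove[OF E(1) a(1), of d] by simp
  then have "real (card {e \<in> E - {a}. d e = 1}) < real k" using a by linarith
  moreover have "real k < real (Suc (card {e \<in> E - {a}. d e = 1}))" using k a by simp
  ultimately show False by (simp only: of_nat_less_iff)
qed

lemma sum_remove2:
  fixes h :: "'b \<Rightarrow> 'v::comm_monoid_add"
  assumes "finite E" "a \<in> E" "b \<in> E" "b \<noteq> a"
  shows "(\<Sum>e\<in>E. h e) = h a + (h b + (\<Sum>e\<in>E - {a, b}. h e))"
proof -
  have "E - {a} - {b} = E - {a, b}" by blast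
  then show ?thesis
    using sum.remove[OF assms(1,2), of h] sum.remove[of "E - {a}" b h] assms by simp
qed

text \<open>The weights form a hypersimplex, whose vertices are the 0-1 weights. Mass is shifted
  between two fractional entries in either direction until one entry becomes integral, and the
  original point lies between the two results.\<close>

lemma bounded_weights_in_hull:
  fixes f :: "'b \<Rightarrow> 'v::real_vector"
  assumes "finite E" "\<And>e. e \<in> E \<Longrightarrow> 0 \<le> d e \<and> d e \<le> (1::real)" "(\<Sum>e\<in>E. d e) = real k"
  shows "(\<Sum>e\<in>E. d e *\<^sub>R f e) \<in> convex hull {(\<Sum>e\<in>S. f e) | S. S \<subseteq> E \<and> card S = k}"
  using assms(2,3)
proof (induction "card {e \<in> E. 0 < d e \<and> d e < 1}" arbitrary: d rule: less_induct)
  case less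
  define H where "H = convex hull {(\<Sum>e\<in>S. f e) | S. S \<subseteq> E \<and> card S = k}"
  show ?case
  proof (cases "\<exists>a\<in>E. 0 < d a \<and> d a < 1")
    case False
    then have d01: "d e = 0 \<or> d e = 1" if "e \<in> E" for e using less.prems(1)[OF that] that by force
    have "(\<Sum>e\<in>E. d e *\<^sub>R (1::real)) = (\<Sum>e\<in>{e \<in> E. d e = 1}. 1)"
      by (rule sum_fractional[OF assms(1) d01])
    then have "card {e \<in> E. d e = 1} = k" using less.prems(2) by simp
    then show ?thesis using sum_fractional[OF assms(1) d01, where f = f]
      by (auto intro!: hull_inc)
  next
    case True
    then obtain a where a: "a \<in> E" "0 < d a" "d a < 1" by blast
    then obtain b where b: "b \<in> E" "b \<noteq> a" "0 < d b" "d b < 1"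
      using another_fractional[OF assms(1) less.prems a] by blast
    \<comment> \<open>\<open>D t\<close> moves mass \<open>t\<close> from \<open>b\<close> to
      \<open>a\<close>; the fact \<open>step\<close> covers the shifts that make one of the two
      weights integral.\<close>
    define D where "D t = d(a := d a + t, b := d b - t)" for t
    have D_sum: "(\<Sum>e\<in>E. D t e *\<^sub>R g e) = (\<Sum>e\<in>E. d e *\<^sub>R g e) + t *\<^sub>R (g a - g b)"
      for t and g :: "'b \<Rightarrow> 'w::real_vector"
    proof -
      have "(\<Sum>e\<in>E - {a, b}. D t e *\<^sub>R g e) = (\<Sum>e\<in>E - {a, b}. d e *\<^sub>R g e)"
        by (rule sum.cong) (auto simp: D_def)
      moreover have "D t a = d a + t" "D t b = d b - t" using b by (auto simp: D_def)
      ultimately show ?thesis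
        unfolding sum_remove2[OF assms(1) a(1) b(1,2)]
        by (simp add: scaleR_add_left scaleR_diff_left scaleR_diff_right)
    qed
    have step: "(\<Sum>e\<in>E. d e *\<^sub>R f e) + t *\<^sub>R (f a - f b) \<in> H"
      if t: "0 \<le> d a + t" "d a + t \<le> 1" "0 \<le> d b - t" "d b - t \<le> 1"
        "d a + t \<in> {0,1} \<or> d b - t \<in> {0,1}" for t
    proof -
      have "0 < d e \<and> d e < 1" if "0 < D t e \<and> D t e < 1" for e
        using that a b by (cases "e = a"; cases "e = b") (auto simp: D_def)
      moreover have "\<exists>e\<in>{a, b}. \<not> (0 < D t e \<and> D t e < 1)"
        using t(5) b(2) by (auto simp: D_def)
      ultimately have "{e \<in> E. 0 < D t e \<and> D t e < 1} \<subset> {e \<in> E. 0 < d e \<and> d e < 1}"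
        using a b by blast
      then have "card {e \<in> E. 0 < D t e \<and> D t e < 1} < card {e \<in> E. 0 < d e \<and> d e < 1}"
        by (rule psubset_card_mono[rotated]) (use assms(1) in simp)
      moreover have "0 \<le> D t e \<and> D t e \<le> 1" if "e \<in> E" for e
        using less.prems(1)[OF that] t by (auto simp: D_def)
      moreover have "(\<Sum>e\<in>E. D t e) = real k"
        using D_sum[of t "\<lambda>_. 1::real"] less.prems(2) by simp
      ultimately show ?thesis using less.hyps[of "D t"] D_sum[of t f] by (simp add: H_def)
    qed
    \<comment> \<open>These are the largest admissible shifts towards \<open>a\<close> and towards
      \<open>b\<close>. Averaging the two results with coefficients inversely proportional to the
      shifts cancels the displacements.\<close>
    define s t where "s = min (1 - d a) (d b)" and "t = min (d a) (1 - d b)"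
    have st: "s > 0" "t > 0" using a b by (auto simp: s_def t_def)
    define P where "P = (\<Sum>e\<in>E. d e *\<^sub>R f e)"
    have 1: "P + s *\<^sub>R (f a - f b) \<in> H"
      unfolding P_def by (rule step) (use a b in \<open>auto simp: s_def min_def\<close>)
    have 2: "P + (- t) *\<^sub>R (f a - f b) \<in> H"
      unfolding P_def by (rule step) (use a b in \<open>auto simp: t_def min_def\<close>)
    have "(t / (s + t)) *\<^sub>R (P + s *\<^sub>R (f a - f b)) + (s / (s + t)) *\<^sub>R (P + (- t) *\<^sub>R (f a - f b)) \<in> H"
      using convexD[OF convex_convex_hull 1[unfolded H_def] 2[unfolded H_def], of "t / (s + t)" "s / (s + t)"] st
      by (simp add: H_def add_divide_distrib[symmetric])
    also have "(t / (s + t)) *\<^sub>R (P + s *\<^sub>R (f a - f b)) + (s / (s + t)) *\<^sub>R (P + (- t) *\<^sub>R (f a - f b))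
      = (t / (s + t) + s / (s + t)) *\<^sub>R P"
      by (simp add: algebra_simps)
    also have "t / (s + t) + s / (s + t) = 1"
      using st by (simp add: add_divide_distrib[symmetric] add.commute)
    finally show ?thesis by (simp add: P_def H_def)
  qed
qed

lemma orthonormal_set_sum_in_real_num_range:
  assumes "finite S" "orthonormal_set S" "card S = k"
  shows "(\<Sum>e\<in>S. qval A e) \<in> real_num_range k A"
proof -
  obtain x where x: "bij_betw x {1..k} S"
    using ex_bij_betw_nat_finite_1[OF assms(1)] assms(3) by auto
  have "corthonormal k x"
    using x assms(2) by (auto simp: corthonormal_def orthonormal_set_def bij_betw_def inj_on_eq_iff)
  moreover have "(\<Sum>e\<in>S. qval A e) = (\<Sum>l=1..k. qval A (x l))"
    using sum.reindex_bij_betw[OF x, of "qval A"] by simp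
  ultimately show ?thesis unfolding real_num_range_def by blast
qed

text \<open>One inclusion is convexity of the ensemble range. For the other, the eigenvalue weights
  are averages of indicators of \<open>k\<close>-element sets of eigenvectors, each of which is an
  orthonormal tuple.\<close>

lemma convex_hull_real_num_range:
  fixes A :: "'m::finite \<Rightarrow> 'a::chilbert_space \<Rightarrow> 'a"
  assumes A: "\<And>j. selfadjoint_op (A j)"
  shows "convex hull (real_num_range k A) = ensemble_range k A"
proof
  show "convex hull real_num_range k A \<subseteq> ensemble_range k A"
    by (intro hull_minimal real_num_range_subset_ensemble convex_ensemble_range A)
  show "ensemble_range k A \<subseteq> convex hull real_num_range k A"
  proof
    fix p assume p_in: "p \<in> ensemble_range k A"
    obtain E d where E: "finite E" "orthonormal_set E" "\<forall>e\<in>E. 0 \<le> d e \<and> d e \<le> 1"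
      "(\<Sum>e\<in>E. d e) = real k" and p: "p = (\<Sum>e\<in>E. d e *\<^sub>R qval A e)"
      by (rule ensemble_range_spectral[OF A p_in])
    have "(\<Sum>e\<in>S. qval A e) \<in> real_num_range k A" if S: "S \<subseteq> E" "card S = k" for S
    proof (rule orthonormal_set_sum_in_real_num_range)
      show "finite S" using E(1) S(1) by (rule finite_subset[rotated])
      show "orthonormal_set S" using E(2) S(1) by (auto simp: orthonormal_set_def subset_iff)
    qed (rule S(2))
    then have "{(\<Sum>e\<in>S. qval A e) | S. S \<subseteq> E \<and> card S = k} \<subseteq> real_num_range k A" by blast
    from hull_mono[OF this, of convex] show "p \<in> convex hull real_num_range k A"
      using bounded_weights_in_hull[OF E(1) E(3)[rule_format] E(4), of "qval A"] unfolding p by blast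
  qed
qed

subsection \<open>Convexity for at most three operators\<close>

text \<open>Formulated without bases, as a supply of directions decoupled from any finite
  configuration.\<close>

definition infinite_dim :: "'a::complex_inner itself \<Rightarrow> bool" where
  "infinite_dim _ \<longleftrightarrow> (\<forall>S :: 'a set. finite S \<longrightarrow> (\<exists>z. norm z = 1 \<and> (\<forall>s\<in>S. cinner z s = 0)))"

lemma line_meets_unit_sphere:
  fixes p d :: "'v::real_normed_vector"
  assumes "norm p \<le> 1" "d \<noteq> 0"
  shows "\<exists>t\<ge>0. norm (p + t *\<^sub>R d) = 1"
proof -
  \<comment> \<open>At parameter \<open>2 / norm d\<close> the norm is at least
    \<open>2 - norm p \<ge> 1\<close>; the intermediate value theorem does the rest.\<close>
  have "norm ((2 / norm d) *\<^sub>R d) - norm p \<le> norm (p + (2 / norm d) *\<^sub>R d)"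
    by (metis add.commute norm_diff_ineq)
  then have "1 \<le> norm (p + (2 / norm d) *\<^sub>R d)" using assms by simp
  then have "\<exists>t\<ge>0. t \<le> 2 / norm d \<and> norm (p + t *\<^sub>R d) = 1"
    using assms by (intro IVT') (auto intro!: continuous_intros)
  then show ?thesis by blast
qed

text \<open>
  If \<open>L\<close> is not injective, it maps the sphere onto the image of the ball; otherwise it is
  bijective, and the ray from \<open>q\<close> through \<open>L p\<close> leaves the solid ellipsoid beyond \<open>L p\<close>.
\<close>

lemma linear_ball_subset_join_sphere:
  fixes L :: "real ^ 3 \<Rightarrow> real ^ 'm::finite"
  assumes L: "linear L" and m: "CARD('m) \<le> 3" and p: "norm p \<le> 1"
  shows "\<exists>v \<tau>. norm v = 1 \<and> 0 \<le> \<tau> \<and> \<tau> \<le> 1 \<and> L p = \<tau> *\<^sub>R L v + (1 - \<tau>) *\<^sub>R q"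
proof (cases "\<exists>d. d \<noteq> 0 \<and> L d = 0")
  case True
  then obtain d where d: "d \<noteq> 0" "L d = 0" by blast
  obtain t where "norm (p + t *\<^sub>R d) = 1" using line_meets_unit_sphere[OF p d(1)] by blast
  moreover have "L (p + t *\<^sub>R d) = L p"
    by (simp add: linear_add[OF L] linear_scale[OF L] d)
  ultimately show ?thesis by (intro exI[of _ "p + t *\<^sub>R d"] exI[of _ 1]) simp
next
  case False
  then have "inj L" using linear_injective_0[OF L] by blast
  \<comment> \<open>A three-dimensional range inside a space of dimension at most three is
    everything, so \<open>L p - q\<close> has a preimage \<open>d\<close>.\<close>
  then have "dim (range L) = 3" using dim_image_eq[OF L, of UNIV] by (simp add: dim_UNIV)
  then have "CARD('m) \<le> dim (range L)" using m by simp
  then have "dim (range L) = DIM(real ^ 'm)" using dim_subset_UNIV[of "range L"] by simp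
  then have "span (range L) = UNIV" by (simp only: dim_eq_full)
  moreover have "span (range L) = range L"
    by (simp add: span_eq_iff linear_subspace_image[OF L])
  ultimately obtain d where d: "L d = L p - q" by (metis UNIV_I image_iff)
  show ?thesis
  proof (cases "d = 0")
    case True
    then have "L p = q" using d by (simp add: linear_0[OF L])
    then show ?thesis by (intro exI[of _ "axis 1 1"] exI[of _ 0]) (simp add: norm_axis_1)
  next
    case False
    obtain t where t: "t \<ge> 0" "norm (p + t *\<^sub>R d) = 1" using line_meets_unit_sphere[OF p False] by blast
    \<comment> \<open>Since \<open>L (p + t *\<^sub>R d) = L p + t *\<^sub>R (L p - q)\<close>, this
      is the weight that returns to \<open>L p\<close> on the segment towards
      \<open>q\<close>.\<close>
    define \<tau> where "\<tau> = 1 / (1 + t)"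
    have \<tau>: "0 \<le> \<tau>" "\<tau> \<le> 1" "\<tau> * t = 1 - \<tau>" using t by (auto simp: \<tau>_def field_simps)
    have "\<tau> *\<^sub>R L (p + t *\<^sub>R d) + (1 - \<tau>) *\<^sub>R q = \<tau> *\<^sub>R L p + (\<tau> * t) *\<^sub>R (L p - q) + (1 - \<tau>) *\<^sub>R q"
      by (simp add: linear_add[OF L] linear_scale[OF L] d scaleR_add_right)
    also have "\<dots> = L p" unfolding \<tau>(3) by (simp add: algebra_simps)
    finally show ?thesis using t \<tau> by (intro exI[of _ "p + t *\<^sub>R d"] exI[of _ \<tau>]) simp
  qed
qed

lemma inner_combination:
  assumes T: "selfadjoint_op T"
  shows "inner (T (\<alpha> *\<^sub>C a + \<beta> *\<^sub>C b)) (\<alpha> *\<^sub>C a + \<beta> *\<^sub>C b)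
    = (cmod \<alpha>)\<^sup>2 * inner (T a) a + (cmod \<beta>)\<^sup>2 * inner (T b) b
      + 2 * Re (\<alpha> * cnj \<beta> * cinner (T a) b)"
proof -
  have "T 0 = 0" using selfadjoint_opD(1)[OF T] by (simp add: linear_simps(3))
  then have "inner (T (\<alpha> *\<^sub>C a)) (\<alpha> *\<^sub>C a) = (cmod \<alpha>)\<^sup>2 * inner (T a) a"
    using selfadjoint_expand[OF T, of 0 \<alpha> a] by simp
  moreover have "cinner (T b) a = cnj (cinner (T a) b)"
    by (metis cinner_commute selfadjoint_opD(3)[OF T])
  then have "Re (\<beta> * cinner (T b) (\<alpha> *\<^sub>C a)) = Re (\<alpha> * cnj \<beta> * cinner (T a) b)"
    by (simp add: cinner_scaleC_right algebra_simps)
  ultimately show ?thesis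
    using selfadjoint_expand[OF T, of "\<alpha> *\<^sub>C a" \<beta> b] by simp
qed

text \<open>
  On the unit sphere of \<open>span {a, b}\<close>, \<open>qval A\<close> factors through the Bloch sphere: with
  \<open>v\<^sub>1 + \<i> v\<^sub>2 = 2 \<alpha> cnj \<beta>\<close> and \<open>v\<^sub>3 = |\<alpha>|\<^sup>2 - |\<beta>|\<^sup>2\<close> it is affine in \<open>v\<close>.
\<close>

lemma qval_segment_subset_join:
  fixes A :: "'m::finite \<Rightarrow> 'a::complex_inner \<Rightarrow> 'a" and q :: "real ^ 'm"
  assumes A: "\<And>j. selfadjoint_op (A j)" and m: "CARD('m) \<le> 3" and s: "0 \<le> s" "s \<le> 1"
  obtains \<alpha> \<beta> \<tau> where "(cmod \<alpha>)\<^sup>2 + (cmod \<beta>)\<^sup>2 = 1" "0 \<le> \<tau>" "\<tau> \<le> 1"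
    "(1 - s) *\<^sub>R qval A a + s *\<^sub>R qval A b
      = \<tau> *\<^sub>R qval A (\<alpha> *\<^sub>C a + \<beta> *\<^sub>C b) + (1 - \<tau>) *\<^sub>R q"
proof -
  define c where "c = (1 / 2) *\<^sub>R (qval A a + qval A b)"
  define L :: "real ^ 3 \<Rightarrow> real ^ 'm" where
    "L v = (\<chi> j. v $ 1 * Re (cinner (A j a) b) - v $ 2 * Im (cinner (A j a) b)
      + v $ 3 * ((inner (A j a) a - inner (A j b) b) / 2))" for v
  have L: "linear L"
    by (rule linearI) (simp_all add: L_def vec_eq_iff algebra_simps add_divide_distrib diff_divide_distrib)
  \<comment> \<open>The Bloch vector of the mixture of \<open>a\<close> and \<open>b\<close> with
    weights \<open>1 - s\<close> and \<open>s\<close>; the value of the mixture is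
    \<open>c + L p\<close>.\<close>
  define p :: "real ^ 3" where "p = (1 - 2 * s) *\<^sub>R axis 3 1"
  have "norm p \<le> 1" using s by (simp add: p_def norm_axis_1 abs_le_iff)
  then obtain v \<tau> where v: "norm v = 1" and \<tau>: "0 \<le> \<tau>" "\<tau> \<le> 1"
    and Lp: "L p = \<tau> *\<^sub>R L v + (1 - \<tau>) *\<^sub>R (q - c)"
    using linear_ball_subset_join_sphere[OF L m] by blast
  have v2: "(v $ 1)\<^sup>2 + (v $ 2)\<^sup>2 + (v $ 3)\<^sup>2 = 1"
    using v by (simp add: norm_eq_1 inner_vec_def sum_3 power2_eq_square)
  \<comment> \<open>A preimage of \<open>v\<close> under the Bloch map. Taking
    \<open>\<alpha>\<close> real and positive determines \<open>\<beta>\<close>, except at the south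
    pole \<open>v $ 3 = - 1\<close>, where \<open>\<alpha>\<close> must vanish.\<close>
  obtain \<alpha> \<beta> where \<alpha>\<beta>: "(cmod \<alpha>)\<^sup>2 = (1 + v $ 3) / 2" "(cmod \<beta>)\<^sup>2 = (1 - v $ 3) / 2"
    "2 * (\<alpha> * cnj \<beta>) = Complex (v $ 1) (v $ 2)"
  proof (cases "v $ 3 = - 1")
    case True
    then have "v $ 1 = 0" "v $ 2 = 0" using v2 by (auto simp: sum_power2_eq_zero_iff)
    with True show thesis by (intro that[of 0 1]) (auto simp: complex_eq_iff)
  next
    case False
    have "(v $ 3)\<^sup>2 \<le> 1" using v2 by (smt (verit) zero_le_power2)
    then have "\<bar>v $ 3\<bar> \<le> 1" by (simp only: abs_square_le_1)
    then have pos: "1 + v $ 3 > 0" using False by (simp add: abs_le_iff)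
    define r where "r = sqrt ((1 + v $ 3) / 2)"
    have r: "r\<^sup>2 = (1 + v $ 3) / 2" "r > 0" using pos by (auto simp: r_def)
    define \<beta> where "\<beta> = Complex (v $ 1) (- (v $ 2)) / of_real (2 * r)"
    have "(cmod \<beta>)\<^sup>2 = ((v $ 1)\<^sup>2 + (v $ 2)\<^sup>2) / (4 * r\<^sup>2)"
      using r(2) by (simp add: \<beta>_def norm_divide power_divide cmod_power2 power_mult_distrib)
    also have "(v $ 1)\<^sup>2 + (v $ 2)\<^sup>2 = (1 + v $ 3) * (1 - v $ 3)"
      using v2 by (simp add: algebra_simps power2_eq_square)
    also have "(1 + v $ 3) * (1 - v $ 3) / (4 * r\<^sup>2) = (1 - v $ 3) / 2"
      using pos unfolding r(1) by (simp add: field_simps)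
    finally show thesis
      using r by (intro that[of "of_real r" \<beta>]) (auto simp: \<beta>_def complex_eq_iff)
  qed
  have "qval A (\<alpha> *\<^sub>C a + \<beta> *\<^sub>C b) = c + L v"
  proof -
    have re: "2 * Re (\<alpha> * cnj \<beta> * g) = v $ 1 * Re g - v $ 2 * Im g" for g
    proof -
      have "2 * Re (\<alpha> * cnj \<beta> * g) = Re ((2 * (\<alpha> * cnj \<beta>)) * g)" by (simp add: algebra_simps)
      then show ?thesis unfolding \<alpha>\<beta>(3) by simp
    qed
    have comp: "inner (A j (\<alpha> *\<^sub>C a + \<beta> *\<^sub>C b)) (\<alpha> *\<^sub>C a + \<beta> *\<^sub>C b)
        = (1 + v $ 3) / 2 * inner (A j a) a + (1 - v $ 3) / 2 * inner (A j b) b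
          + (v $ 1 * Re (cinner (A j a) b) - v $ 2 * Im (cinner (A j a) b))" for j
      by (simp only: inner_combination[OF A] \<alpha>\<beta>(1,2) re)
    show ?thesis by (simp add: vec_eq_iff qval_def L_def c_def comp) (simp add: field_simps)
  qed
  moreover have "(1 - s) *\<^sub>R qval A a + s *\<^sub>R qval A b = c + L p"
    by (simp add: vec_eq_iff qval_def L_def c_def p_def axis_def field_simps)
  ultimately have "(1 - s) *\<^sub>R qval A a + s *\<^sub>R qval A b
      = \<tau> *\<^sub>R qval A (\<alpha> *\<^sub>C a + \<beta> *\<^sub>C b) + (1 - \<tau>) *\<^sub>R q"
    by (simp add: Lp algebra_simps)
  moreover have "(cmod \<alpha>)\<^sup>2 + (cmod \<beta>)\<^sup>2 = 1" by (simp add: \<alpha>\<beta> field_simps)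
  ultimately show thesis using \<tau> that by simp
qed

section \<open>Merging fractional weights\<close>

lemma qval_add_decoupled:
  assumes A: "\<And>j. selfadjoint_op (A j)" and z: "\<And>j. cinner (A j x) z = 0"
  shows "qval A (\<alpha> *\<^sub>C x + \<beta> *\<^sub>C z) = (cmod \<alpha>)\<^sup>2 *\<^sub>R qval A x + (cmod \<beta>)\<^sup>2 *\<^sub>R qval A z"
  by (simp add: vec_eq_iff qval_def inner_combination[OF A] z)

lemma cinner_orthonormal_combination:
  assumes "cinner a a = 1" "cinner b b = 1" "cinner a b = 0"
  shows "cinner (\<alpha> *\<^sub>C a + \<beta> *\<^sub>C b) (\<gamma> *\<^sub>C a + \<delta> *\<^sub>C b) = \<alpha> * cnj \<gamma> + \<beta> * cnj \<delta>"
  using assms cinner_eq_zero_commute[of a b]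
  by (simp add: cinner_add_left cinner_add_right cinner_scaleC_left cinner_scaleC_right)

text \<open>Induction on the number of fractional weights. Two vectors \<open>a\<close>,
  \<open>b\<close> of fractional weight are replaced by vectors in the span of \<open>a\<close>,
  \<open>b\<close> and a far-away \<open>z\<close>: one of weight \<open>d a + d b\<close> if this
  is at most 1, otherwise one of weight 1 and one of weight \<open>d a + d b - 1\<close>.\<close>

lemma weights_in_real_num_range:
  fixes A :: "'m::finite \<Rightarrow> 'a::complex_inner \<Rightarrow> 'a"
  assumes A: "\<And>j. selfadjoint_op (A j)" and m: "CARD('m) \<le> 3" and inf: "infinite_dim TYPE('a)"
    and "finite E" "orthonormal_set E" "\<And>e. e \<in> E \<Longrightarrow> 0 \<le> d e \<and> d e \<le> 1"
    and "(\<Sum>e\<in>E. d e) = real k"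
  shows "(\<Sum>e\<in>E. d e *\<^sub>R qval A e) \<in> real_num_range k A"
  using assms(4-7)
proof (induction "card {e \<in> E. 0 < d e \<and> d e < 1}" arbitrary: E d rule: less_induct)
  case less
  note E = less.prems(1,2) and d = less.prems(3,4)
  show ?case
  proof (cases "\<exists>a\<in>E. 0 < d a \<and> d a < 1")
    case False
    then have d01: "d e = 0 \<or> d e = 1" if "e \<in> E" for e using d(1)[OF that] that by force
    have "(\<Sum>e\<in>E. d e *\<^sub>R (1::real)) = (\<Sum>e\<in>{e \<in> E. d e = 1}. 1)"
      by (rule sum_fractional[OF E(1) d01])
    then have "card {e \<in> E. d e = 1} = k" using d(2) by simp
    then have "(\<Sum>e\<in>{e \<in> E. d e = 1}. qval A e) \<in> real_num_range k A"
      using E by (intro orthonormal_set_sum_in_real_num_range) (auto simp: orthonormal_set_def)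
    then show ?thesis using sum_fractional[OF E(1) d01, where f = "qval A"] by simp
  next
    case True
    then obtain a where a: "a \<in> E" "0 < d a" "d a < 1" by blast
    then obtain b where b: "b \<in> E" "b \<noteq> a" "0 < d b" "d b < 1"
      using another_fractional[OF E(1) d a] by blast
    \<comment> \<open>Orthogonality of \<open>z\<close> to the vectors \<open>A j a\<close> and
      \<open>A j b\<close> removes the cross terms, so superposing \<open>z\<close> mixes values
      affinely.\<close>
    define S where "S = E \<union> range (\<lambda>j. A j a) \<union> range (\<lambda>j. A j b)"
    have "finite S" using E(1) by (simp add: S_def)
    then obtain z where z: "norm z = 1" "\<forall>s\<in>S. cinner z s = 0"
      using inf[unfolded infinite_dim_def, rule_format] by metis
    have zz: "cinner z z = 1" using z(1) by (simp add: cinner_self)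
    have zE: "cinner e z = 0" "cinner z e = 0" if "e \<in> E" for e
      using z(2) that by (auto simp: S_def cinner_eq_zero_commute[of e z])
    have zA: "cinner (A j (\<alpha> *\<^sub>C a + \<beta> *\<^sub>C b)) z = 0" for j \<alpha> \<beta>
    proof -
      have "cinner (A j a) z = 0" "cinner (A j b) z = 0"
        using z(2) cinner_eq_zero_commute[of "A j a" z] cinner_eq_zero_commute[of "A j b" z]
        by (auto simp: S_def)
      moreover have "A j (x + y) = A j x + A j y" for j x y
        using selfadjoint_opD(1)[OF A] by (simp add: linear_simps(1))
      ultimately show ?thesis
        by (simp add: selfadjoint_opD(2)[OF A] cinner_add_left cinner_scaleC_left)
    qed
    have ab: "cinner a a = 1" "cinner b b = 1" "cinner a b = 0" "cinner b a = 0"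
      "cinner a z = 0" "cinner b z = 0" "cinner z a = 0" "cinner z b = 0"
      using E(2) a(1) b(1,2) zE by (auto simp: orthonormal_set_def)
    define E0 where "E0 = E - {a, b}"
    have E0: "finite E0" "orthonormal_set E0" using E by (auto simp: E0_def orthonormal_set_def)
    have perp0: "cinner e (\<alpha> *\<^sub>C a + \<beta> *\<^sub>C b + \<gamma> *\<^sub>C z) = 0" "cinner (\<alpha> *\<^sub>C a + \<beta> *\<^sub>C b + \<gamma> *\<^sub>C z) e = 0"
      if "e \<in> E0" for e \<alpha> \<beta> \<gamma>
    proof -
      have "cinner e a = 0" "cinner e b = 0" "cinner e z = 0"
        using E(2) a(1) b(1) that zE by (auto simp: orthonormal_set_def E0_def)
      then show "cinner e (\<alpha> *\<^sub>C a + \<beta> *\<^sub>C b + \<gamma> *\<^sub>C z) = 0"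
        by (simp add: cinner_add_right cinner_scaleC_right)
      then show "cinner (\<alpha> *\<^sub>C a + \<beta> *\<^sub>C b + \<gamma> *\<^sub>C z) e = 0" by (simp only: cinner_eq_zero_commute)
    qed
    define frac where "frac = {e \<in> E0. 0 < d e \<and> d e < 1}"
    have frac_card: "card {e \<in> E. 0 < d e \<and> d e < 1} = card frac + 2"
    proof -
      have "{e \<in> E. 0 < d e \<and> d e < 1} = insert a (insert b frac)"
        using a b by (auto simp: frac_def E0_def)
      then show ?thesis using E0(1) b(2) by (simp add: frac_def E0_def)
    qed
    have split: "(\<Sum>e\<in>E. d e *\<^sub>R qval A e) = d a *\<^sub>R qval A a + d b *\<^sub>R qval A b
        + (\<Sum>e\<in>E0. d e *\<^sub>R qval A e)"
      "real k = d a + d b + (\<Sum>e\<in>E0. d e)"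
      using sum_remove2[OF E(1) a(1) b(1,2), of "\<lambda>e. d e *\<^sub>R qval A e"]
        sum_remove2[OF E(1) a(1) b(1,2), of d] d(2) by (simp_all add: E0_def add.assoc)
    show ?thesis
    proof (cases "d a + d b \<le> 1")
      case True
      define s where "s = d b / (d a + d b)"
      have s: "0 \<le> s" "s \<le> 1" "(d a + d b) * (1 - s) = d a" "(d a + d b) * s = d b"
        using a b by (auto simp: s_def field_simps)
      obtain \<alpha> \<beta> \<tau> where *: "(cmod \<alpha>)\<^sup>2 + (cmod \<beta>)\<^sup>2 = 1" "0 \<le> \<tau>" "\<tau> \<le> 1"
        "(1 - s) *\<^sub>R qval A a + s *\<^sub>R qval A b
          = \<tau> *\<^sub>R qval A (\<alpha> *\<^sub>C a + \<beta> *\<^sub>C b) + (1 - \<tau>) *\<^sub>R qval A z"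
        by (rule qval_segment_subset_join[OF A m s(1,2)])
      define v where "v = \<alpha> *\<^sub>C a + \<beta> *\<^sub>C b"
      \<comment> \<open>Square roots of the weights serve as amplitudes, so a single unit vector
        realises the point on the segment to the value at \<open>z\<close>.\<close>
      define u where "u = of_real (sqrt \<tau>) *\<^sub>C v + of_real (sqrt (1 - \<tau>)) *\<^sub>C z"
      have "\<alpha> * cnj \<alpha> + \<beta> * cnj \<beta> = 1"
        using *(1) by (simp only: complex_norm_square[symmetric] of_real_add[symmetric]) simp
      then have vv: "cinner v v = 1" "cinner v z = 0"
        by (simp_all add: v_def cinner_orthonormal_combination ab)
          (simp add: cinner_add_left cinner_scaleC_left ab)
      have "complex_of_real (sqrt \<tau>) * of_real (sqrt \<tau>) + of_real (sqrt (1 - \<tau>)) * of_real (sqrt (1 - \<tau>)) = 1"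
        using *(2,3) by (simp flip: of_real_mult of_real_add)
      then have uu: "cinner u u = 1"
        by (simp add: u_def cinner_orthonormal_combination vv zz)
      have qu: "qval A u = (1 - s) *\<^sub>R qval A a + s *\<^sub>R qval A b"
        using *(2,3) zA unfolding u_def *(4) v_def by (subst qval_add_decoupled[OF A]) auto
      have u0: "cinner e u = 0" "cinner u e = 0" if "e \<in> E0" for e
        using perp0[OF that, of "of_real (sqrt \<tau>) * \<alpha>" "of_real (sqrt \<tau>) * \<beta>" "of_real (sqrt (1 - \<tau>))"]
        by (simp_all add: u_def v_def scaleC_add_right scaleC_scaleC)
      have "u \<notin> E0" using u0 uu by force
      define d' where "d' = d(u := d a + d b)"
      have same: "(\<Sum>e\<in>E0. d' e *\<^sub>R g e) = (\<Sum>e\<in>E0. d e *\<^sub>R g e)" for g :: "'a \<Rightarrow> 'w::real_vector"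
        using \<open>u \<notin> E0\<close> by (intro sum.cong) (auto simp: d'_def)
      have "(\<Sum>e\<in>insert u E0. d' e *\<^sub>R qval A e) \<in> real_num_range k A"
      proof (rule less.hyps)
        have "{e \<in> insert u E0. 0 < d' e \<and> d' e < 1} \<subseteq> insert u frac"
          by (auto simp: d'_def frac_def split: if_splits)
        then have "card {e \<in> insert u E0. 0 < d' e \<and> d' e < 1} \<le> card (insert u frac)"
          by (intro card_mono) (use E0 in \<open>auto simp: frac_def\<close>)
        also have "\<dots> \<le> card frac + 1" using card_insert_le_m1[of "card frac + 1" frac u] by simp
        finally show "card {e \<in> insert u E0. 0 < d' e \<and> d' e < 1} < card {e \<in> E. 0 < d e \<and> d e < 1}"
          using frac_card by simp
        show "orthonormal_set (insert u E0)"
          using E0(2) u0 uu \<open>u \<notin> E0\<close> by (auto simp: orthonormal_set_def)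
        show "0 \<le> d' e \<and> d' e \<le> 1" if "e \<in> insert u E0" for e
          using that d(1)[of e] a b True by (auto simp: d'_def E0_def)
        show "sum d' (insert u E0) = real k"
          using same[of "\<lambda>_. 1::real"] E0(1) \<open>u \<notin> E0\<close> split(2) by (simp add: d'_def)
      qed (use E0 in simp)
      moreover have "(\<Sum>e\<in>insert u E0. d' e *\<^sub>R qval A e) = (\<Sum>e\<in>E. d e *\<^sub>R qval A e)"
      proof -
        have "(d a + d b) *\<^sub>R qval A u = d a *\<^sub>R qval A a + d b *\<^sub>R qval A b"
          by (simp add: qu scaleR_add_right s)
        then show ?thesis using same[of "qval A"] E0(1) \<open>u \<notin> E0\<close> by (simp add: split(1) d'_def)
      qed
      ultimately show ?thesis by simp
    next
      case False
      \<comment> \<open>The weights split as \<open>\<delta>\<close> on both vectors plus a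
        remainder of total mass \<open>1 - \<delta>\<close>, namely \<open>1 - d b\<close> at
        \<open>a\<close> and \<open>1 - d a\<close> at \<open>b\<close>.\<close>
      define \<delta> where "\<delta> = d a + d b - 1"
      have \<delta>: "0 < \<delta>" "\<delta> < 1" using False a b by (auto simp: \<delta>_def)
      define s where "s = (1 - d a) / (1 - \<delta>)"
      have s: "0 \<le> s" "s \<le> 1" "(1 - \<delta>) * (1 - s) = 1 - d b" "(1 - \<delta>) * s = 1 - d a"
        using a b \<delta> by (auto simp: s_def \<delta>_def field_simps)
      obtain \<alpha> \<beta> \<tau> where *: "(cmod \<alpha>)\<^sup>2 + (cmod \<beta>)\<^sup>2 = 1" "0 \<le> \<tau>" "\<tau> \<le> 1"
        "(1 - s) *\<^sub>R qval A a + s *\<^sub>R qval A b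
          = \<tau> *\<^sub>R qval A (\<alpha> *\<^sub>C a + \<beta> *\<^sub>C b) + (1 - \<tau>) *\<^sub>R qval A z"
        by (rule qval_segment_subset_join[OF A m s(1,2)])
      define v where "v = \<alpha> *\<^sub>C a + \<beta> *\<^sub>C b"
      \<comment> \<open>\<open>w\<close> completes \<open>v\<close> to an orthonormal basis of the
        plane. The remainder puts weight \<open>(1 - \<delta>) * \<tau>\<close> on \<open>v\<close>
        and \<open>1 - r\<close> on \<open>z\<close>; the plane adds \<open>\<delta>\<close> on
        \<open>v\<close> and on \<open>w\<close>. The parts on \<open>v\<close> and \<open>z\<close>
        are gathered into the unit vector \<open>u\<close>.\<close>
      define w where "w = (- cnj \<beta>) *\<^sub>C a + cnj \<alpha> *\<^sub>C b"
      define r where "r = (1 - \<delta>) * \<tau> + \<delta>"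
      have r: "0 \<le> r" "r \<le> 1" "1 - r = (1 - \<delta>) * (1 - \<tau>)"
      proof -
        show "1 - r = (1 - \<delta>) * (1 - \<tau>)" by (simp add: r_def algebra_simps)
        moreover have "0 \<le> (1 - \<delta>) * (1 - \<tau>)" using \<delta> *(3) by simp
        ultimately show "r \<le> 1" by linarith
        show "0 \<le> r" using \<delta> *(2) by (simp add: r_def)
      qed
      define u where "u = of_real (sqrt r) *\<^sub>C v + of_real (sqrt (1 - r)) *\<^sub>C z"
      have "\<alpha> * cnj \<alpha> + \<beta> * cnj \<beta> = 1"
        using *(1) by (simp only: complex_norm_square[symmetric] of_real_add[symmetric]) simp
      then have vv: "cinner v v = 1" "cinner w w = 1" "cinner v w = 0"
        by (simp_all only: v_def w_def cinner_orthonormal_combination[OF ab(1-3)])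
          (simp_all add: algebra_simps)
      have vz: "cinner v z = 0" "cinner z w = 0"
        by (simp_all add: v_def w_def cinner_add_left cinner_add_right cinner_scaleC_left
            cinner_diff_right cinner_scaleC_right ab)
      have "complex_of_real (sqrt r) * of_real (sqrt r) + of_real (sqrt (1 - r)) * of_real (sqrt (1 - r)) = 1"
        using r(1,2) by (simp flip: of_real_mult of_real_add)
      then have "cinner u u = 1"
        by (simp add: u_def cinner_orthonormal_combination vv vz zz)
      moreover have "cinner u w = 0"
        by (simp add: u_def cinner_add_left cinner_scaleC_left vv vz)
      ultimately have uu: "cinner u u = 1" "cinner u w = 0" "cinner w u = 0"
        by (simp_all add: cinner_eq_zero_commute[of w])
      have qu: "qval A u = r *\<^sub>R qval A v + (1 - r) *\<^sub>R qval A z"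
        using r zA unfolding u_def v_def by (subst qval_add_decoupled[OF A]) auto
      \<comment> \<open>The trace over the plane spanned by \<open>a\<close> and \<open>b\<close>
        does not depend on the orthonormal basis.\<close>
      have qvw: "qval A v + qval A w = qval A a + qval A b"
      proof -
        have cancel: "(x * X + y * Y + G) + (y * X + x * Y - G) = X + Y"
          if "x + y = 1" for x y X Y G :: real
        proof -
          have "(x * X + y * Y + G) + (y * X + x * Y - G) = (x + y) * (X + Y)"
            by (simp add: algebra_simps)
          then show ?thesis by (simp add: that)
        qed
        have "inner (A j v) v = (cmod \<alpha>)\<^sup>2 * inner (A j a) a + (cmod \<beta>)\<^sup>2 * inner (A j b) b
            + 2 * Re (\<alpha> * cnj \<beta> * cinner (A j a) b)" for j
          unfolding v_def by (rule inner_combination[OF A])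
        moreover have "inner (A j w) w = (cmod \<beta>)\<^sup>2 * inner (A j a) a + (cmod \<alpha>)\<^sup>2 * inner (A j b) b
            - 2 * Re (\<alpha> * cnj \<beta> * cinner (A j a) b)" for j
          unfolding w_def inner_combination[OF A] by (simp add: algebra_simps)
        ultimately have "inner (A j v) v + inner (A j w) w = inner (A j a) a + inner (A j b) b" for j
          by (simp only: cancel[OF *(1)])
        then show ?thesis by (simp add: vec_eq_iff qval_def)
      qed
      have u0: "cinner e u = 0" "cinner u e = 0" if "e \<in> E0" for e
        using perp0[OF that, of "of_real (sqrt r) * \<alpha>" "of_real (sqrt r) * \<beta>" "of_real (sqrt (1 - r))"]
        by (simp_all add: u_def v_def scaleC_add_right scaleC_scaleC)
      have w0: "cinner e w = 0" "cinner w e = 0" if "e \<in> E0" for e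
        using perp0[OF that, of "- cnj \<beta>" "cnj \<alpha>" 0] by (simp_all add: w_def)
      have notin: "u \<notin> E0" "w \<notin> E0" "u \<noteq> w" using u0 w0 uu vv by force+
      define d' where "d' = d(u := 1, w := \<delta>)"
      have same: "(\<Sum>e\<in>E0. d' e *\<^sub>R g e) = (\<Sum>e\<in>E0. d e *\<^sub>R g e)" for g :: "'a \<Rightarrow> 'w::real_vector"
        using notin by (intro sum.cong) (auto simp: d'_def)
      have "(\<Sum>e\<in>insert u (insert w E0). d' e *\<^sub>R qval A e) \<in> real_num_range k A"
      proof (rule less.hyps)
        have "{e \<in> insert u (insert w E0). 0 < d' e \<and> d' e < 1} \<subseteq> insert w frac"
          using notin by (auto simp: d'_def frac_def split: if_splits)
        then have "card {e \<in> insert u (insert w E0). 0 < d' e \<and> d' e < 1} \<le> card (insert w frac)"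
          by (intro card_mono) (use E0 in \<open>auto simp: frac_def\<close>)
        also have "\<dots> \<le> card frac + 1" using card_insert_le_m1[of "card frac + 1" frac w] by simp
        finally show "card {e \<in> insert u (insert w E0). 0 < d' e \<and> d' e < 1}
            < card {e \<in> E. 0 < d e \<and> d e < 1}"
          using frac_card by simp
        show "orthonormal_set (insert u (insert w E0))"
          using E0(2) u0 w0 uu vv notin by (auto simp: orthonormal_set_def)
        show "0 \<le> d' e \<and> d' e \<le> 1" if "e \<in> insert u (insert w E0)" for e
          using that d(1)[of e] \<delta> by (auto simp: d'_def E0_def)
        show "sum d' (insert u (insert w E0)) = real k"
          using same[of "\<lambda>_. 1::real"] E0(1) notin split(2) by (simp add: d'_def \<delta>_def)
      qed (use E0 in simp)
      moreover have "(\<Sum>e\<in>insert u (insert w E0). d' e *\<^sub>R qval A e) = (\<Sum>e\<in>E. d e *\<^sub>R qval A e)"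
      proof -
        have "qval A u + \<delta> *\<^sub>R qval A w
            = (1 - \<delta>) *\<^sub>R (\<tau> *\<^sub>R qval A v + (1 - \<tau>) *\<^sub>R qval A z) + \<delta> *\<^sub>R (qval A v + qval A w)"
          unfolding qu r(3) by (simp add: r_def algebra_simps)
        also have "\<dots> = ((1 - \<delta>) * (1 - s)) *\<^sub>R qval A a + ((1 - \<delta>) * s) *\<^sub>R qval A b
            + \<delta> *\<^sub>R (qval A a + qval A b)"
          unfolding qvw *(4)[symmetric, folded v_def] by (simp add: scaleR_add_right)
        also have "\<dots> = d a *\<^sub>R qval A a + d b *\<^sub>R qval A b"
          unfolding s(3,4) by (simp add: \<delta>_def algebra_simps)
        finally show ?thesis
          using same[of "qval A"] E0(1) notin by (simp add: split(1) d'_def add.assoc[symmetric])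
      qed
      ultimately show ?thesis by simp
    qed
  qed
qed

lemma ensemble_range_eq_real_num_range:
  fixes A :: "'m::finite \<Rightarrow> 'a::chilbert_space \<Rightarrow> 'a"
  assumes A: "\<And>j. selfadjoint_op (A j)" and "CARD('m) \<le> 3" "infinite_dim TYPE('a)"
  shows "ensemble_range k A = real_num_range k A"
proof
  show "ensemble_range k A \<subseteq> real_num_range k A"
  proof
    fix p assume p_in: "p \<in> ensemble_range k A"
    obtain E d where E: "finite E" "orthonormal_set E" "\<forall>e\<in>E. 0 \<le> d e \<and> d e \<le> 1"
      "(\<Sum>e\<in>E. d e) = real k" and p: "p = (\<Sum>e\<in>E. d e *\<^sub>R qval A e)"
      by (rule ensemble_range_spectral[OF A p_in])
    show "p \<in> real_num_range k A"
      unfolding p by (rule weights_in_real_num_range[OF assms E(1,2) E(3)[rule_format] E(4)])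
  qed
qed (rule real_num_range_subset_ensemble)

subsection \<open>Limit points of the range\<close>

text \<open>Cauchy-Schwarz in each summand: a positive operator is bounded by its trace.\<close>

lemma besselian_trace:
  fixes us :: "'a::complex_inner list"
  shows "besselian (\<Sum>u\<leftarrow>us. (norm u)\<^sup>2) us"
  unfolding besselian_def
proof
  fix z :: 'a
  have "(cmod (cinner z u))\<^sup>2 \<le> (norm u)\<^sup>2 * (norm z)\<^sup>2" for u :: 'a
    using power_mono[OF cinner_cauchy_schwarz norm_ge_zero, of z u 2]
    by (simp add: power_mult_distrib mult.commute)
  then have "(\<Sum>u\<leftarrow>us. (cmod (cinner z u))\<^sup>2) \<le> (\<Sum>u\<leftarrow>us. (norm u)\<^sup>2 * (norm z)\<^sup>2)"
    by (intro sum_list_mono)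
  then show "(\<Sum>u\<leftarrow>us. (cmod (cinner z u))\<^sup>2) \<le> (\<Sum>u\<leftarrow>us. (norm u)\<^sup>2) * (norm z)\<^sup>2"
    by (simp add: sum_list_mult_const)
qed

lemma cinner_orthonormal_residual:
  assumes E: "finite E" "orthonormal_set E" and f: "f \<in> E"
  shows "cinner (z - (\<Sum>e\<in>E. cinner z e *\<^sub>C e)) f = 0"
proof -
  have "cinner (\<Sum>e\<in>E. cinner z e *\<^sub>C e) f = (\<Sum>e\<in>E. if e = f then cinner z e else 0)"
    using E(2) f by (auto simp: cinner_sum_left cinner_scaleC_left orthonormal_set_def intro!: sum.cong)
  then show ?thesis using E(1) f by (simp add: cinner_diff_left)
qed

lemma gram_schmidt:
  fixes S :: "'a::complex_inner set"
  assumes "finite S"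
  shows "\<exists>E. finite E \<and> orthonormal_set E \<and> S \<subseteq> cvec.span E"
  using assms
proof (induction S rule: finite_induct)
  case empty
  then show ?case by (intro exI[of _ "{}"]) (simp add: orthonormal_set_def)
next
  case (insert s S)
  then obtain E where E: "finite E" "orthonormal_set E" "S \<subseteq> cvec.span E" by blast
  define r where "r = s - (\<Sum>e\<in>E. cinner s e *\<^sub>C e)"
  have r: "cinner r f = 0" if "f \<in> E" for f
    unfolding r_def by (rule cinner_orthonormal_residual[OF E(1,2) that])
  have sum_span: "(\<Sum>e\<in>E. cinner s e *\<^sub>C e) \<in> cvec.span E"
    by (intro cvec.span_sum cvec.span_scale cvec.span_base)
  show ?case
  proof (cases "r = 0")
    case True
    then have "s \<in> cvec.span E" using sum_span by (simp add: r_def)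
    then show ?thesis using E by blast
  next
    case False
    define f where "f = (1 / norm r) *\<^sub>R r"
    have ff: "cinner f f = 1"
      using False by (simp add: f_def cinner_self power2_eq_square)
    have fe: "cinner f e = 0" "cinner e f = 0" if "e \<in> E" for e
      using r[OF that] cinner_eq_zero_commute[of r e] by (simp_all add: f_def)
    have sub: "cvec.span E \<subseteq> cvec.span (insert f E)" by (intro cvec.span_mono) blast
    have "r = of_real (norm r) *\<^sub>C f" using False by (simp add: scaleC_of_real f_def)
    then have "r \<in> cvec.span (insert f E)"
      by (metis cvec.span_scale cvec.span_base insertI1)
    then have "r + (\<Sum>e\<in>E. cinner s e *\<^sub>C e) \<in> cvec.span (insert f E)"
      using sum_span sub by (blast intro: cvec.span_add)
    then have "s \<in> cvec.span (insert f E)" by (simp add: r_def)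
    then have "insert s S \<subseteq> cvec.span (insert f E)" using E(3) sub by blast
    moreover have "orthonormal_set (insert f E)"
      using E(2) ff fe by (auto simp: orthonormal_set_def)
    ultimately show ?thesis using E(1) by (intro exI[of _ "insert f E"]) simp
  qed
qed

section \<open>Far-away blocks from weakly null vectors\<close>

lemma tendsto_quadratic_perturb:
  fixes T :: "'a::real_inner \<Rightarrow> 'a"
  assumes T: "bounded_linear T" and y: "\<And>n. norm (y n) \<le> C" and d: "(d \<longlongrightarrow> 0) G"
  shows "((\<lambda>n. inner (T (y n + d n)) (y n + d n) - inner (T (y n)) (y n)) \<longlongrightarrow> 0) G"
proof -
  interpret T: bounded_linear T by fact
  obtain K where K: "K \<ge> 0" "\<And>x. norm (T x) \<le> norm x * K" using T.nonneg_bounded by blast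
  have bound: "norm (inner (T (y n + d n)) (y n + d n) - inner (T (y n)) (y n))
      \<le> norm (d n) * K * C + C * K * norm (d n) + norm (d n) * K * norm (d n)" for n
  proof -
    have C: "C \<ge> 0" using y[of n] norm_ge_zero[of "y n"] by linarith
    have "\<bar>inner (T x) z\<bar> \<le> a * K * b" if "norm x \<le> a" "norm z \<le> b" for x z a b
    proof -
      have "0 \<le> a" "0 \<le> b" using that norm_ge_zero order_trans by blast+
      have "\<bar>inner (T x) z\<bar> \<le> norm (T x) * norm z" by (rule Cauchy_Schwarz_ineq2)
      also have "\<dots> \<le> a * K * b"
        using K that \<open>0 \<le> a\<close> by (intro mult_mono order_trans[OF K(2)] mult_right_mono) auto
      finally show ?thesis .
    qed
    from this[of "d n" _ "y n" C] this[of "y n" C "d n"] this[of "d n" _ "d n"] y[of n]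
    have "\<bar>inner (T (d n)) (y n)\<bar> \<le> norm (d n) * K * C" "\<bar>inner (T (y n)) (d n)\<bar> \<le> C * K * norm (d n)"
      "\<bar>inner (T (d n)) (d n)\<bar> \<le> norm (d n) * K * norm (d n)" by auto
    moreover have "inner (T (y n + d n)) (y n + d n) - inner (T (y n)) (y n)
        = inner (T (d n)) (y n) + inner (T (y n)) (d n) + inner (T (d n)) (d n)"
      by (simp add: T.add inner_add_left inner_add_right)
    ultimately show ?thesis unfolding real_norm_def by linarith
  qed
  have "((\<lambda>n. norm (d n) * K * C + C * K * norm (d n) + norm (d n) * K * norm (d n)) \<longlongrightarrow>
      norm (0::'a) * K * C + C * K * norm (0::'a) + norm (0::'a) * K * norm (0::'a)) G"
    by (intro tendsto_intros d)
  then have "((\<lambda>n. norm (d n) * K * C + C * K * norm (d n) + norm (d n) * K * norm (d n)) \<longlongrightarrow> 0) G"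
    by simp
  then show ?thesis by (rule Lim_null_comparison[OF always_eventually[OF allI[OF bound]]])
qed

text \<open>Projecting a weakly null family off a finite-dimensional space changes it by a norm-null
  amount, so value and mass keep their limits. Rescaling makes the mass exactly
  \<open>\<sigma>\<close>, and one index far along \<open>G\<close> suffices.\<close>

lemma far_block:
  fixes y :: "nat \<Rightarrow> 'b \<Rightarrow> 'a::complex_inner" and v :: "real ^ 'm::finite"
  assumes A: "\<And>j. selfadjoint_op (A j)" and G: "G \<noteq> bot"
    and weak: "\<And>l z. l \<in> {1..k} \<Longrightarrow> ((\<lambda>n. inner (y l n) z) \<longlongrightarrow> 0) G"
    and C: "\<And>l n. l \<in> {1..k} \<Longrightarrow> norm (y l n) \<le> C"
    and lim_norm: "((\<lambda>n. \<Sum>l=1..k. (norm (y l n))\<^sup>2) \<longlongrightarrow> \<sigma>) G" and \<sigma>: "\<sigma> > 0"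
    and lim_val: "((\<lambda>n. \<Sum>l=1..k. qval A (y l n)) \<longlongrightarrow> v) G"
    and S: "finite S" and \<epsilon>: "\<epsilon> > 0"
  shows "\<exists>ys. (\<forall>u\<in>set ys. \<forall>s\<in>S. cinner u s = 0) \<and> (\<Sum>u\<leftarrow>ys. (norm u)\<^sup>2) = \<sigma>
    \<and> norm ((\<Sum>u\<leftarrow>ys. qval A u) - v) < \<epsilon>"
proof -
  obtain E where E: "finite E" "orthonormal_set E" "S \<subseteq> cvec.span E" using gram_schmidt[OF S] by blast
  \<comment> \<open>The correction removes the component in the span of \<open>E\<close>; its
    finitely many coefficients tend to zero, so it is norm-null.\<close>
  define d where "d l n = - (\<Sum>e\<in>E. cinner (y l n) e *\<^sub>C e)" for l n
  have d0: "(d l \<longlongrightarrow> 0) G" if l: "l \<in> {1..k}" for l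
  proof (rule Lim_null_comparison[OF always_eventually])
    have "((\<lambda>n. cinner (y l n) e) \<longlongrightarrow> cinner 0 e) G" for e
      by (rule tendsto_cinner_left) (simp add: weak[OF l])
    then have "((\<lambda>n. \<Sum>e\<in>E. cmod (cinner (y l n) e) * norm e) \<longlongrightarrow> (\<Sum>e\<in>E. cmod (cinner 0 e) * norm e)) G"
      by (intro tendsto_sum tendsto_mult_right tendsto_norm)
    then show "((\<lambda>n. \<Sum>e\<in>E. cmod (cinner (y l n) e) * norm e) \<longlongrightarrow> 0) G" by simp
    show "\<forall>n. norm (d l n) \<le> (\<Sum>e\<in>E. cmod (cinner (y l n) e) * norm e)"
      unfolding d_def norm_minus_cancel norm_scaleC[symmetric] by (intro allI norm_sum)
  qed
  have quad: "((\<lambda>n. \<Sum>l=1..k. inner (T (y l n + d l n)) (y l n + d l n)) \<longlongrightarrow> L) G"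
    if T: "bounded_linear T" and L: "((\<lambda>n. \<Sum>l=1..k. inner (T (y l n)) (y l n)) \<longlongrightarrow> L) G" for T L
  proof -
    have "((\<lambda>n. \<Sum>l=1..k. (inner (T (y l n + d l n)) (y l n + d l n) - inner (T (y l n)) (y l n)))
        \<longlongrightarrow> (\<Sum>l=1..k. 0)) G"
      using C d0 by (intro tendsto_sum tendsto_quadratic_perturb[OF T]) auto
    from tendsto_add[OF this L] show ?thesis by (simp add: sum_subtractf)
  qed
  have n_lim: "((\<lambda>n. \<Sum>l=1..k. (norm (y l n + d l n))\<^sup>2) \<longlongrightarrow> \<sigma>) G"
    using quad[OF bounded_linear_ident, of \<sigma>] lim_norm by (simp only: power2_norm_eq_inner)
  have v_lim: "((\<lambda>n. \<Sum>l=1..k. qval A (y l n + d l n)) \<longlongrightarrow> v) G"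
  proof (rule vec_tendstoI)
    fix j
    have "((\<lambda>n. \<Sum>l=1..k. inner (A j (y l n)) (y l n)) \<longlongrightarrow> v $ j) G"
      using tendsto_vec_nth[OF lim_val, of j] by (simp add: qval_def)
    from quad[OF selfadjoint_opD(1)[OF A] this]
    show "((\<lambda>n. (\<Sum>l=1..k. qval A (y l n + d l n)) $ j) \<longlongrightarrow> v $ j) G" by (simp add: qval_def)
  qed
  define c where "c n = \<sigma> / (\<Sum>l=1..k. (norm (y l n + d l n))\<^sup>2)" for n
  have "(c \<longlongrightarrow> \<sigma> / \<sigma>) G" unfolding c_def using n_lim \<sigma> by (intro tendsto_intros) auto
  then have "((\<lambda>n. c n *\<^sub>R (\<Sum>l=1..k. qval A (y l n + d l n))) \<longlongrightarrow> 1 *\<^sub>R v) G"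
    using \<sigma> v_lim by (intro tendsto_scaleR) auto
  then have "\<forall>\<^sub>F n in G. dist (c n *\<^sub>R (\<Sum>l=1..k. qval A (y l n + d l n))) v < \<epsilon>"
    using \<epsilon> by (simp add: tendsto_iff)
  moreover have "\<forall>\<^sub>F n in G. (\<Sum>l=1..k. (norm (y l n + d l n))\<^sup>2) > 0"
    using n_lim \<sigma> by (rule order_tendstoD)
  ultimately obtain n where n: "dist (c n *\<^sub>R (\<Sum>l=1..k. qval A (y l n + d l n))) v < \<epsilon>"
    "(\<Sum>l=1..k. (norm (y l n + d l n))\<^sup>2) > 0"
    using eventually_happens'[OF G eventually_conj] by blast
  have c: "c n > 0" "c n * (\<Sum>l=1..k. (norm (y l n + d l n))\<^sup>2) = \<sigma>" using n(2) \<sigma> by (auto simp: c_def)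
  define ys where "ys = map (\<lambda>u. sqrt (c n) *\<^sub>R u) (map (\<lambda>l. y l n + d l n) [1..<Suc k])"
  have "(\<Sum>u\<leftarrow>ys. (norm u)\<^sup>2) = \<sigma>"
    unfolding ys_def sum_list_norm_scaleR sum_list_map_upt using c by simp
  moreover have "(\<Sum>u\<leftarrow>ys. qval A u) = c n *\<^sub>R (\<Sum>l=1..k. qval A (y l n + d l n))"
    unfolding ys_def sum_list_qval_scaleR[OF A] sum_list_map_upt using c by simp
  moreover have "cinner u s = 0" if u_in: "u \<in> set ys" and s_in: "s \<in> S" for u s
  proof -
    obtain l where u: "u = sqrt (c n) *\<^sub>R (y l n + d l n)" using u_in by (auto simp: ys_def)
    have "cinner (y l n + d l n) f = 0" if "f \<in> E" for f
      using cinner_orthonormal_residual[OF E(1,2) that, of "y l n"] by (simp add: d_def)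
    then have "cinner f u = 0" if "f \<in> E" for f
      using that by (simp add: u cinner_eq_zero_commute[of f])
    then have "cinner s u = 0" using cinner_span_eq_0[of s E u] s_in E(3) by blast
    then show ?thesis by (simp only: cinner_eq_zero_commute)
  qed
  ultimately show ?thesis using n(1) by (intro exI[of _ ys]) (simp add: dist_norm)
qed

text \<open>Each new block is chosen orthogonal to all earlier ones, so mass and value grow with
  \<open>N\<close> while the Bessel bound stays at \<open>\<sigma>\<close>.\<close>

lemma iterate_blocks:
  fixes v :: "real ^ 'm::finite" and S :: "'a::complex_inner set"
  assumes block: "\<And>S :: 'a set. finite S \<Longrightarrow> \<exists>ys. (\<forall>u\<in>set ys. \<forall>s\<in>S. cinner u s = 0)
      \<and> (\<Sum>u\<leftarrow>ys. (norm u)\<^sup>2) = \<sigma> \<and> norm ((\<Sum>u\<leftarrow>ys. qval A u) - v) < \<epsilon>"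
    and \<sigma>: "\<sigma> > 0" and S: "finite S"
  shows "\<exists>ys. (\<forall>u\<in>set ys. \<forall>s\<in>S. cinner u s = 0) \<and> besselian \<sigma> ys
    \<and> (\<Sum>u\<leftarrow>ys. (norm u)\<^sup>2) = real N * \<sigma> \<and> norm ((\<Sum>u\<leftarrow>ys. qval A u) - real N *\<^sub>R v) \<le> real N * \<epsilon>"
proof (induction N)
  case 0
  show ?case using \<sigma> by (intro exI[of _ "[]"]) (simp add: besselian_def)
next
  case (Suc N)
  then obtain ys where ys: "\<forall>u\<in>set ys. \<forall>s\<in>S. cinner u s = 0" "besselian \<sigma> ys"
    "(\<Sum>u\<leftarrow>ys. (norm u)\<^sup>2) = real N * \<sigma>" "norm ((\<Sum>u\<leftarrow>ys. qval A u) - real N *\<^sub>R v) \<le> real N * \<epsilon>"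
    by blast
  have "finite (S \<union> set ys)" using S by simp
  then obtain zs where zs: "\<forall>u\<in>set zs. \<forall>s\<in>S \<union> set ys. cinner u s = 0"
    "(\<Sum>u\<leftarrow>zs. (norm u)\<^sup>2) = \<sigma>" "norm ((\<Sum>u\<leftarrow>zs. qval A u) - v) < \<epsilon>"
    using block by blast
  have "besselian \<sigma> zs" using besselian_trace[of zs] zs(2) by simp
  then have "besselian \<sigma> (zs @ ys)"
    using ys(2) \<sigma> zs(1) by (intro besselian_append_orthogonal) auto
  moreover have "norm ((\<Sum>u\<leftarrow>zs @ ys. qval A u) - real (Suc N) *\<^sub>R v) \<le> real (Suc N) * \<epsilon>"
  proof -
    have "(\<Sum>u\<leftarrow>zs @ ys. qval A u) - real (Suc N) *\<^sub>R v
        = ((\<Sum>u\<leftarrow>zs. qval A u) - v) + ((\<Sum>u\<leftarrow>ys. qval A u) - real N *\<^sub>R v)"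
      by (simp add: algebra_simps)
    also have "norm \<dots> \<le> \<epsilon> + real N * \<epsilon>" using zs(3) ys(4) by (intro norm_triangle_mono) auto
    finally show ?thesis by (simp add: algebra_simps)
  qed
  ultimately show ?case using ys zs by (intro exI[of _ "zs @ ys"]) (auto simp: algebra_simps)
qed

text \<open>The mass \<open>\<gamma> * \<sigma>\<close> is spread over \<open>N\<close> mutually
  orthogonal blocks; for large \<open>N\<close> each carries so little that the operator stays below
  the identity, whatever the size of \<open>\<gamma>\<close>.\<close>

lemma far_blocks_in_closure:
  fixes v :: "real ^ 'm::finite" and xs :: "'a::complex_inner list"
  assumes A: "\<And>j. selfadjoint_op (A j)"
    and block: "\<And>(S :: 'a set) \<epsilon>. finite S \<Longrightarrow> \<epsilon> > 0 \<Longrightarrow> \<exists>ys. (\<forall>u\<in>set ys. \<forall>s\<in>S. cinner u s = 0)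
      \<and> (\<Sum>u\<leftarrow>ys. (norm u)\<^sup>2) = \<sigma> \<and> norm ((\<Sum>u\<leftarrow>ys. qval A u) - v) < \<epsilon>"
    and \<sigma>: "\<sigma> > 0" and \<gamma>: "\<gamma> \<ge> 0"
    and xs: "besselian 1 xs" "(\<Sum>u\<leftarrow>xs. (norm u)\<^sup>2) + \<gamma> * \<sigma> = real k"
  shows "(\<Sum>u\<leftarrow>xs. qval A u) + \<gamma> *\<^sub>R v \<in> closure (ensemble_range k A)"
  unfolding closure_approachable
proof (intro allI impI)
  fix e :: real assume e: "e > 0"
  \<comment> \<open>\<open>N \<ge> \<gamma> * \<sigma>\<close> keeps the Bessel bound at most 1; the
    extra 1 keeps \<open>N\<close> positive even for \<open>\<gamma> = 0\<close>.\<close>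
  obtain N :: nat where "\<gamma> * \<sigma> + 1 \<le> real N" using real_arch_simple by blast
  moreover have "0 \<le> \<gamma> * \<sigma>" using \<gamma> \<sigma> by simp
  ultimately have N: "\<gamma> * \<sigma> \<le> real N" "real N > 0" by linarith+
  \<comment> \<open>The errors of the \<open>N\<close> blocks, each scaled by
    \<open>\<gamma> / N\<close>, add up to at most \<open>\<gamma> * \<epsilon>\<close>,
    independently of \<open>N\<close>.\<close>
  define \<epsilon> where "\<epsilon> = e / (\<gamma> + 1)"
  have \<epsilon>: "\<epsilon> > 0" "\<gamma> * \<epsilon> < e" using e \<gamma> by (auto simp: \<epsilon>_def field_simps)
  obtain ys where ys: "\<forall>u\<in>set ys. \<forall>s\<in>set xs. cinner u s = 0" "besselian \<sigma> ys"
    "(\<Sum>u\<leftarrow>ys. (norm u)\<^sup>2) = real N * \<sigma>" "norm ((\<Sum>u\<leftarrow>ys. qval A u) - real N *\<^sub>R v) \<le> real N * \<epsilon>"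
    using iterate_blocks[OF block[OF _ \<epsilon>(1)] \<sigma>, of "set xs" N] by auto
  define r where "r = sqrt (\<gamma> / real N)"
  have r: "r\<^sup>2 = \<gamma> / real N" using \<gamma> by (simp add: r_def)
  define us where "us = map (\<lambda>u. r *\<^sub>R u) ys @ xs"
  have "r\<^sup>2 * \<sigma> \<le> 1" using N by (simp add: r field_simps)
  then have "besselian 1 (map (\<lambda>u. r *\<^sub>R u) ys)"
    using besselian_mono[OF besselian_scale[OF ys(2)]] by blast
  then have "besselian 1 us"
    unfolding us_def using ys(1) xs(1) by (intro besselian_append_orthogonal) auto
  moreover have "(\<Sum>u\<leftarrow>us. (norm u)\<^sup>2) = real k"
    unfolding us_def map_append sum_list_append sum_list_norm_scaleR r ys(3) using xs(2) N(2) by simp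
  ultimately have "(\<Sum>u\<leftarrow>us. qval A u) \<in> ensemble_range k A" by (intro ensemble_rangeI) auto
  moreover have "dist (\<Sum>u\<leftarrow>us. qval A u) ((\<Sum>u\<leftarrow>xs. qval A u) + \<gamma> *\<^sub>R v) < e"
  proof -
    have "(\<Sum>u\<leftarrow>us. qval A u) - ((\<Sum>u\<leftarrow>xs. qval A u) + \<gamma> *\<^sub>R v)
        = (\<gamma> / real N) *\<^sub>R ((\<Sum>u\<leftarrow>ys. qval A u) - real N *\<^sub>R v)"
      unfolding us_def map_append sum_list_append sum_list_qval_scaleR[OF A] r
      using N(2) by (simp add: scaleR_diff_right)
    also have "norm \<dots> \<le> (\<gamma> / real N) * (real N * \<epsilon>)"
      unfolding norm_scaleR using ys(4) \<gamma> by (intro mult_mono) auto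
    also have "\<dots> < e" using \<epsilon>(2) N(2) by simp
    finally show ?thesis by (simp add: dist_norm)
  qed
  ultimately show "\<exists>p\<in>ensemble_range k A. dist p ((\<Sum>u\<leftarrow>xs. qval A u) + \<gamma> *\<^sub>R v) < e" by blast
qed

text \<open>A limit point that is not attained loses mass \<open>\<sigma> > 0\<close> in the weak
  limit. The lost mass yields blocks orthogonal to any finite set, hence infinite dimension. Placing
  one more unit of mass there reaches the closure of the ensemble range for \<open>k + 1\<close>,
  from which \<open>p\<close> is recovered by averaging.\<close>

lemma closure_real_num_range:
  fixes A :: "'m::finite \<Rightarrow> 'a::chilbert_space \<Rightarrow> 'a"
  assumes A: "\<And>j. selfadjoint_op (A j)" and p: "p \<in> closure (real_num_range k A)"
    and not_in: "p \<notin> real_num_range k A"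
  shows "infinite_dim TYPE('a) \<and> (closed (ensemble_range (k + 1) A) \<longrightarrow> p \<in> ensemble_range k A)"
proof -
  obtain P where "\<forall>n. P n \<in> real_num_range k A" and P: "P \<longlonglongrightarrow> p"
    using p unfolding closure_sequential by blast
  then have "\<forall>n. \<exists>x. corthonormal k x \<and> P n = (\<Sum>l=1..k. qval A (x l))"
    unfolding real_num_range_def by blast
  then obtain X where X: "\<And>n. corthonormal k (X n)" and PX: "\<And>n. P n = (\<Sum>l=1..k. qval A (X n l))"
    by metis
  have X1: "norm (X n l) = 1" if "l \<in> {1..k}" for l n by (rule norm_corthonormal[OF X that])
  obtain G x where G: "G \<le> sequentially" "G \<noteq> bot"
    and weak: "\<forall>l\<in>{1..k}. \<forall>z. ((\<lambda>n. inner (X n l) z) \<longlongrightarrow> inner (x l) z) G"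
    using weak_cluster_finite[of "{1..k}" sequentially "\<lambda>l n. X n l" 1] X1 by auto
  have PG: "(P \<longlongrightarrow> p) G" using P G(1) by (rule tendsto_mono[rotated])
  define xs where "xs = map x [1..<Suc k]"
  define a where "a = (\<Sum>u\<leftarrow>xs. qval A u)"
  define \<sigma> where "\<sigma> = real k - (\<Sum>u\<leftarrow>xs. (norm u)\<^sup>2)"
  define y where "y l n = X n l - x l" for l n
  have y_weak: "((\<lambda>n. inner (y l n) z) \<longlongrightarrow> 0) G" if "l \<in> {1..k}" for l z
    using tendsto_diff[OF weak[rule_format, OF that, of z] tendsto_const[of "inner (x l) z"]]
    by (simp add: y_def inner_diff_left)
  \<comment> \<open>The cross terms pair the weakly null \<open>y l n\<close> with fixed vectors and
    vanish in the limit, so quadratic sums split into a weak-limit part and a remainder.\<close>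
  have quad: "((\<lambda>n. \<Sum>l=1..k. inner (T (y l n)) (y l n)) \<longlongrightarrow> L - (\<Sum>l=1..k. inner (T (x l)) (x l))) G"
    if T: "selfadjoint_op T" and L: "((\<lambda>n. \<Sum>l=1..k. inner (T (X n l)) (X n l)) \<longlongrightarrow> L) G" for T L
  proof -
    have "inner (T (X n l)) (X n l) - inner (T (x l)) (x l) - 2 * inner (y l n) (T (x l))
        = inner (T (y l n)) (y l n)" for n l
    proof -
      have "inner (T (y l n)) (x l) = inner (y l n) (T (x l))"
        by (simp add: Re_cinner[symmetric] selfadjoint_opD(3)[OF T])
      moreover have "T (X n l) = T (x l) + T (y l n)" "X n l = x l + y l n"
        using linear_simps(1)[OF selfadjoint_opD(1)[OF T], of "x l" "y l n"] by (simp_all add: y_def)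
      ultimately show ?thesis
        by (simp only: inner_add_left inner_add_right) (simp add: inner_commute)
    qed
    moreover have "((\<lambda>n. (\<Sum>l=1..k. inner (T (X n l)) (X n l)) - (\<Sum>l=1..k. inner (T (x l)) (x l))
        - 2 * (\<Sum>l=1..k. inner (y l n) (T (x l))))
        \<longlongrightarrow> L - (\<Sum>l=1..k. inner (T (x l)) (x l)) - 2 * (\<Sum>l=1..k. 0)) G"
      by (intro tendsto_intros L y_weak)
    ultimately show ?thesis by (simp add: sum_subtractf[symmetric] sum_distrib_left)
  qed
  have lim_norm: "((\<lambda>n. \<Sum>l=1..k. (norm (y l n))\<^sup>2) \<longlongrightarrow> \<sigma>) G"
  proof -
    have "(\<lambda>n. \<Sum>l=1..k. inner (X n l) (X n l)) = (\<lambda>n. real k)"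
      using X1 by (simp add: power2_norm_eq_inner[symmetric])
    then have "((\<lambda>n. \<Sum>l=1..k. inner (X n l) (X n l)) \<longlongrightarrow> real k) G" by simp
    from quad[OF selfadjoint_op_id this] show ?thesis
      unfolding \<sigma>_def xs_def sum_list_map_upt by (simp only: power2_norm_eq_inner)
  qed
  have lim_val: "((\<lambda>n. \<Sum>l=1..k. qval A (y l n)) \<longlongrightarrow> p - a) G"
  proof (rule vec_tendstoI)
    fix j
    have "((\<lambda>n. \<Sum>l=1..k. inner (A j (X n l)) (X n l)) \<longlongrightarrow> p $ j) G"
      using tendsto_vec_nth[OF PG, of j] by (simp add: PX qval_def)
    from quad[OF A this]
    show "((\<lambda>n. (\<Sum>l=1..k. qval A (y l n)) $ j) \<longlongrightarrow> (p - a) $ j) G"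
      unfolding a_def xs_def sum_list_map_upt by (simp add: qval_def)
  qed
  have "\<sigma> \<ge> 0"
    by (rule tendsto_lowerbound[OF lim_norm _ G(2)]) (simp add: sum_nonneg)
  \<comment> \<open>Without lost mass the convergence is strong, so the limit vectors are
    orthonormal and attain \<open>p\<close>.\<close>
  have "\<sigma> \<noteq> 0"
  proof
    assume "\<sigma> = 0"
    have y0: "(y l \<longlongrightarrow> 0) G" if l: "l \<in> {1..k}" for l
    proof -
      have "(norm (y l n))\<^sup>2 \<le> (\<Sum>l=1..k. (norm (y l n))\<^sup>2)" for n
        using l by (intro member_le_sum) auto
      then have "\<forall>n. norm ((norm (y l n))\<^sup>2) \<le> (\<Sum>l=1..k. (norm (y l n))\<^sup>2)" by simp
      then have "((\<lambda>n. (norm (y l n))\<^sup>2) \<longlongrightarrow> 0) G"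
        by (rule Lim_null_comparison[OF always_eventually lim_norm[unfolded \<open>\<sigma> = 0\<close>]])
      then have "((\<lambda>n. sqrt ((norm (y l n))\<^sup>2)) \<longlongrightarrow> sqrt 0) G" by (rule tendsto_real_sqrt)
      then show ?thesis by (simp add: tendsto_norm_zero_iff)
    qed
    have "corthonormal k x"
      unfolding corthonormal_def
    proof (intro ballI)
      fix i j assume i: "i \<in> {1..k}" and j: "j \<in> {1..k}"
      \<comment> \<open>\<open>X n j\<close> is split into its weak limit and a norm-null remainder,
        as inner products of two merely weakly convergent families need not converge to that of the
        limits.\<close>
      have "((\<lambda>n. cinner (X n i) (x j)) \<longlongrightarrow> cinner (x i) (x j)) G"
        by (rule tendsto_cinner_left) (use weak i in blast)
      moreover have "((\<lambda>n. cinner (X n i) (y j n)) \<longlongrightarrow> 0) G"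
      proof (rule Lim_null_comparison[OF always_eventually])
        show "\<forall>n. cmod (cinner (X n i) (y j n)) \<le> norm (y j n)"
          using cinner_cauchy_schwarz[of "X _ i" "y j _"] X1[OF i] by (metis mult_1)
        show "((\<lambda>n. norm (y j n)) \<longlongrightarrow> 0) G" using y0[OF j] by (rule tendsto_norm_zero)
      qed
      ultimately have "((\<lambda>n. cinner (X n i) (x j) + cinner (X n i) (y j n)) \<longlongrightarrow> cinner (x i) (x j) + 0) G"
        by (rule tendsto_add)
      moreover have "cinner (X n i) (x j) + cinner (X n i) (y j n) = (if i = j then 1 else 0)" for n
        using X[of n] i j by (simp add: cinner_add_right[symmetric] y_def corthonormal_def)
      ultimately show "cinner (x i) (x j) = (if i = j then 1 else 0)"
        using tendsto_unique[OF G(2) tendsto_const] by fastforce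
    qed
    moreover have "((\<lambda>n. \<Sum>l=1..k. qval A (y l n)) \<longlongrightarrow> 0) G"
    proof (rule vec_tendstoI)
      fix j
      have "((\<lambda>n. \<Sum>l=1..k. inner (A j (0 + y l n)) (0 + y l n) - inner (A j 0) 0) \<longlongrightarrow> (\<Sum>l=1..k. 0)) G"
        using y0 by (intro tendsto_sum tendsto_quadratic_perturb[OF selfadjoint_opD(1)[OF A], of _ 0]) auto
      then show "((\<lambda>n. (\<Sum>l=1..k. qval A (y l n)) $ j) \<longlongrightarrow> 0 $ j) G" by (simp add: qval_def)
    qed
    then have "p = a" using tendsto_unique[OF G(2) lim_val] by fastforce
    ultimately have "p \<in> real_num_range k A"
      unfolding real_num_range_def a_def xs_def sum_list_map_upt by blast
    then show False using not_in by blast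
  qed
  then have \<sigma>: "\<sigma> > 0" using \<open>\<sigma> \<ge> 0\<close> by simp
  define C where "C = 1 + (\<Sum>l=1..k. norm (x l))"
  have C: "norm (y l n) \<le> C" if "l \<in> {1..k}" for l n
  proof -
    have "norm (x l) \<le> (\<Sum>l=1..k. norm (x l))" using that by (intro member_le_sum) auto
    then show ?thesis using norm_triangle_ineq4[of "X n l" "x l"] X1[OF that, of n]
      by (simp add: y_def C_def)
  qed
  have block: "\<exists>ys. (\<forall>u\<in>set ys. \<forall>s\<in>S. cinner u s = 0) \<and> (\<Sum>u\<leftarrow>ys. (norm u)\<^sup>2) = \<sigma>
      \<and> norm ((\<Sum>u\<leftarrow>ys. qval A u) - (p - a)) < \<epsilon>" if "finite S" "\<epsilon> > 0" for S :: "'a set" and \<epsilon>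
    by (rule far_block[OF A G(2) y_weak C lim_norm \<sigma> lim_val that])
  have "infinite_dim TYPE('a)"
    unfolding infinite_dim_def
  proof (intro allI impI)
    fix S :: "'a set" assume "finite S"
    then obtain ys where ys: "\<forall>u\<in>set ys. \<forall>s\<in>S. cinner u s = 0" "(\<Sum>u\<leftarrow>ys. (norm u)\<^sup>2) = \<sigma>"
      using block[of S 1] by auto
    have "\<exists>u\<in>set ys. u \<noteq> 0"
    proof (rule ccontr)
      assume "\<not> ?thesis"
      then have "(\<Sum>u\<leftarrow>ys. (norm u)\<^sup>2) = 0" by (induction ys) auto
      then show False using ys(2) \<sigma> by simp
    qed
    then obtain u where "u \<in> set ys" "u \<noteq> 0" by blast
    then show "\<exists>z. norm z = 1 \<and> (\<forall>s\<in>S. cinner z s = 0)"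
      using ys(1) by (intro exI[of _ "(1 / norm u) *\<^sub>R u"]) simp
  qed
  moreover have "p \<in> ensemble_range k A" if closed: "closed (ensemble_range (k + 1) A)"
  proof -
    \<comment> \<open>Bessel's inequality for \<open>X n\<close> involves finitely many inner
      products with \<open>z\<close>, so it survives the weak limit.\<close>
    have xs: "besselian 1 xs"
      unfolding besselian_def
    proof
      fix z
      have "((\<lambda>n. cinner (X n l) z) \<longlongrightarrow> cinner (x l) z) G" if "l \<in> {1..k}" for l
        by (rule tendsto_cinner_left) (use weak that in blast)
      then have "((\<lambda>n. \<Sum>l=1..k. (cmod (cinner (X n l) z))\<^sup>2) \<longlongrightarrow> (\<Sum>l=1..k. (cmod (cinner (x l) z))\<^sup>2)) G"
        by (intro tendsto_sum tendsto_power tendsto_norm)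
      moreover have swap: "cmod (cinner u w) = cmod (cinner w u)" for u w :: 'a
        by (metis cinner_commute complex_mod_cnj)
      have "(\<Sum>l=1..k. (cmod (cinner (X n l) z))\<^sup>2) \<le> 1 * (norm z)\<^sup>2" for n
        using besselian_corthonormal[OF X[of n]] unfolding besselian_def sum_list_map_upt swap[of _ z]
        by blast
      ultimately have "(\<Sum>l=1..k. (cmod (cinner (x l) z))\<^sup>2) \<le> 1 * (norm z)\<^sup>2"
        by (intro tendsto_upperbound[OF _ always_eventually G(2)]) auto
      then show "(\<Sum>u\<leftarrow>xs. (cmod (cinner z u))\<^sup>2) \<le> 1 * (norm z)\<^sup>2"
        unfolding xs_def sum_list_map_upt swap[of z] .
    qed
    \<comment> \<open>With \<open>\<gamma> = (\<sigma> + 1) / \<sigma>\<close> the far blocks carry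
      mass \<open>\<sigma> + 1\<close>; added to the mass \<open>k - \<sigma>\<close> of
      \<open>xs\<close> this makes \<open>k + 1\<close>.\<close>
    have "a + ((\<sigma> + 1) / \<sigma>) *\<^sub>R (p - a) \<in> closure (ensemble_range (k + 1) A)"
      unfolding a_def
      by (rule far_blocks_in_closure[OF A block[unfolded a_def] \<sigma> _ xs]) (use \<sigma> in \<open>auto simp: \<sigma>_def\<close>)
    then have "a + ((\<sigma> + 1) / \<sigma>) *\<^sub>R (p - a) \<in> ensemble_range (k + 1) A"
      using closed by (simp add: closure_closed)
    then obtain us where us: "besselian 1 us" "(\<Sum>u\<leftarrow>us. (norm u)\<^sup>2) = real (k + 1)"
      "a + ((\<sigma> + 1) / \<sigma>) *\<^sub>R (p - a) = (\<Sum>u\<leftarrow>us. qval A u)"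
      unfolding ensemble_range_def by blast
    \<comment> \<open>The weight \<open>r\<close> inverts the factor
      \<open>(\<sigma> + 1) / \<sigma>\<close>, so averaging with \<open>a\<close> returns to
      \<open>p\<close>; the same \<open>r\<close> brings the trace back to \<open>k\<close>.\<close>
    define r where "r = \<sigma> / (\<sigma> + 1)"
    have "\<sigma> + 1 > 0" using \<sigma> by simp
    then have r_mult: "r * (\<sigma> + 1) = \<sigma>" by (simp add: r_def)
    have r: "0 \<le> r" "r \<le> 1" using \<sigma> by (auto simp: r_def)
    have r_inverse: "r * ((\<sigma> + 1) / \<sigma>) = 1" using r_mult \<sigma> by (simp add: times_divide_eq_right)
    have r_trace: "(1 - r) * (real k - \<sigma>) + r * (real k + 1) = real k"
      using r_mult by (simp add: algebra_simps)
    define ws where "ws = map (\<lambda>u. sqrt (1 - r) *\<^sub>R u) xs @ map (\<lambda>u. sqrt r *\<^sub>R u) us"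
    show ?thesis
    proof (rule ensemble_rangeI)
      show "besselian 1 ws"
        using besselian_append[OF besselian_scale[OF xs, of "sqrt (1 - r)"] besselian_scale[OF us(1), of "sqrt r"]] r
        by (simp add: ws_def)
      show "(\<Sum>u\<leftarrow>ws. (norm u)\<^sup>2) = real k"
        unfolding ws_def map_append sum_list_append sum_list_norm_scaleR us(2)
        using r r_trace by (simp add: \<sigma>_def add.commute)
      have "(\<Sum>u\<leftarrow>ws. qval A u) = (1 - r) *\<^sub>R a + r *\<^sub>R (a + ((\<sigma> + 1) / \<sigma>) *\<^sub>R (p - a))"
        unfolding ws_def map_append sum_list_append sum_list_qval_scaleR[OF A] us(3)[symmetric] a_def
        using r by simp
      also have "\<dots> = a + (r * ((\<sigma> + 1) / \<sigma>)) *\<^sub>R (p - a)"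
        by (simp only: scaleR_add_right scaleR_scaleR) (simp add: scaleR_diff_left)
      finally show "p = (\<Sum>u\<leftarrow>ws. qval A u)" by (simp only: r_inverse) simp
    qed
  qed
  ultimately show ?thesis by blast
qed

section \<open>Closedness of the range and of its hull\<close>

lemma bounded_real_num_range:
  assumes A: "\<And>j. selfadjoint_op (A j)"
  shows "bounded (real_num_range k A)"
proof -
  have "\<exists>K. \<forall>x. norm x = 1 \<longrightarrow> \<bar>inner (A j x) x\<bar> \<le> K" for j
  proof -
    obtain K where K: "\<And>x. norm (A j x) \<le> norm x * K"
      using bounded_linear.bounded[OF selfadjoint_opD(1)[OF A]] by blast
    have "\<bar>inner (A j x) x\<bar> \<le> K" if "norm x = 1" for x
      using Cauchy_Schwarz_ineq2[of "A j x" x] K[of x] that by simp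
    then show ?thesis by blast
  qed
  then obtain K where K: "\<And>j x. norm x = 1 \<Longrightarrow> \<bar>inner (A j x) x\<bar> \<le> K j" by metis
  have q: "norm (qval A x) \<le> (\<Sum>j\<in>UNIV. K j)" if "norm x = 1" for x
    using norm_le_l1_cart[of "qval A x"] sum_mono[of UNIV "\<lambda>j. \<bar>qval A x $ j\<bar>" K] K[OF that]
    by (simp add: qval_def)
  have "norm p \<le> real k * (\<Sum>j\<in>UNIV. K j)" if "p \<in> real_num_range k A" for p
  proof -
    obtain x where x: "corthonormal k x" "p = (\<Sum>l=1..k. qval A (x l))"
      using \<open>p \<in> real_num_range k A\<close> unfolding real_num_range_def by blast
    have "norm p \<le> (\<Sum>l=1..k. norm (qval A (x l)))" unfolding x(2) by (rule norm_sum)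
    also have "\<dots> \<le> (\<Sum>l=1..k. (\<Sum>j\<in>UNIV. K j))"
      by (intro sum_mono q norm_corthonormal[OF x(1)])
    finally show ?thesis by simp
  qed
  then show ?thesis unfolding bounded_iff by blast
qed

text \<open>A missing limit point would force infinite dimension, where the ensemble range agrees
  with the range for \<open>k\<close> and for \<open>k + 1\<close>, and then the point belongs to
  the range after all. Finite dimension admits no missing limit point.\<close>

lemma closed_real_num_range:
  fixes A :: "'m::finite \<Rightarrow> 'a::chilbert_space \<Rightarrow> 'a"
  assumes A: "\<And>j. selfadjoint_op (A j)" and m: "CARD('m) \<le> 3"
    and closed: "closed (real_num_range (k + 1) A)"
  shows "closed (real_num_range k A)"
proof -
  have "p \<in> real_num_range k A" if p: "p \<in> closure (real_num_range k A)" for p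
  proof (rule ccontr)
    assume not_in: "p \<notin> real_num_range k A"
    from closure_real_num_range[OF A p not_in] show False
      using ensemble_range_eq_real_num_range[OF A m] closed not_in by auto
  qed
  then show ?thesis by (metis closure_subset closure_eq subsetI subset_antisym)
qed

text \<open>It is enough to treat limit points of the range itself: the hull of its compact closure
  is compact, and once that closure lies in the ensemble range the two hulls coincide.\<close>

lemma closed_convex_hull_real_num_range:
  fixes A :: "'m::finite \<Rightarrow> 'a::chilbert_space \<Rightarrow> 'a"
  assumes A: "\<And>j. selfadjoint_op (A j)"
    and closed: "closed (convex hull real_num_range (k + 1) A)"
  shows "closed (convex hull real_num_range k A)"
proof -
  have "closure (real_num_range k A) \<subseteq> ensemble_range k A"
    using closure_real_num_range[where A = A, OF A] real_num_range_subset_ensemble[of k A] closed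
    unfolding convex_hull_real_num_range[where A = A, OF A] by blast
  then have "convex hull closure (real_num_range k A) \<subseteq> convex hull real_num_range k A"
    unfolding convex_hull_real_num_range[OF A] by (intro hull_minimal convex_ensemble_range A)
  moreover have "convex hull real_num_range k A \<subseteq> convex hull closure (real_num_range k A)"
    by (intro hull_mono closure_subset)
  moreover have "compact (convex hull closure (real_num_range k A))"
    by (intro compact_convex_hull) (simp add: compact_closure bounded_real_num_range[OF A])
  ultimately show ?thesis by (simp add: compact_imp_closed subset_antisym)
qed

section \<open>Passage to complex coordinates\<close>

definition complex_vec :: "real ^ 'm \<Rightarrow> complex ^ 'm" where
  "complex_vec v = (\<chi> j. of_real (v $ j))"

lemma linear_complex_vec: "linear complex_vec"
  by (rule linearI) (simp_all add: complex_vec_def vec_eq_iff complex_eq_iff)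

lemma inj_complex_vec: "inj complex_vec"
  by (rule injI) (simp add: complex_vec_def vec_eq_iff)

lemma joint_num_range_eq:
  fixes A :: "'m::finite \<Rightarrow> 'a::complex_inner \<Rightarrow> 'a"
  assumes A: "\<And>j. selfadjoint_op (A j)"
  shows "joint_num_range k A = complex_vec ` real_num_range k A"
proof -
  have "cinner (A j x) x = of_real (inner (A j x) x)" for j x
  proof -
    have "cnj (cinner (A j x) x) = cinner (A j x) x"
      by (metis cinner_commute selfadjoint_opD(3)[OF A])
    then show ?thesis by (simp add: complex_eq_iff Re_cinner)
  qed
  then have "(\<chi> j. \<Sum>l=1..k. cinner (A j (x l)) (x l)) = complex_vec (\<Sum>l=1..k. qval A (x l))" for x
    by (simp add: vec_eq_iff complex_vec_def qval_def)
  then show ?thesis unfolding joint_num_range_def real_num_range_def by auto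
qed

theorem theorem4p6:
  fixes A :: "'m::finite \<Rightarrow> 'a::chilbert_space \<Rightarrow> 'a"
    and k :: nat
  assumes "k \<ge> 1"
    and "enat k < cdimension TYPE('a)"
    and "\<And>j. selfadjoint_op (A j)"
  shows "(CARD('m) \<le> 3 \<longrightarrow>
            closed (joint_num_range (k + 1) A) \<longrightarrow> closed (joint_num_range k A))
       \<and> (CARD('m) \<ge> 4 \<longrightarrow>
            closed (convex hull (joint_num_range (k + 1) A)) \<longrightarrow>
            closed (convex hull (joint_num_range k A)))
       \<and> (CARD('m) \<ge> 4 \<longrightarrow>
            closed (joint_num_range (k + 1) A) \<longrightarrow>
            closed (convex hull (joint_num_range k A)))"
proof -
  note A = assms(3)
  \<comment> \<open>\<open>complex_vec\<close> is linear and injective between finite-dimensional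
    spaces, so it commutes with convex hulls and preserves closedness in both directions.\<close>
  have closed_iff: "closed (joint_num_range n A) \<longleftrightarrow> closed (real_num_range n A)"
    and hull_iff: "closed (convex hull joint_num_range n A) \<longleftrightarrow> closed (convex hull real_num_range n A)" for n
    by (simp_all add: joint_num_range_eq[OF A] convex_hull_linear_image[OF linear_complex_vec, symmetric]
        closed_injective_linear_image_eq[OF linear_complex_vec inj_complex_vec])
  \<comment> \<open>In finite-dimensional coordinates a closed bounded range is compact, and so is
    its hull; this reduces the third claim to the second.\<close>
  have "closed (convex hull real_num_range n A)" if "closed (real_num_range n A)" for n
    using that bounded_real_num_range[where A = A, OF A]
    by (intro compact_imp_closed compact_convex_hull) (simp add: compact_eq_bounded_closed)
  then show ?thesis
    unfolding closed_iff hull_iff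
    using closed_real_num_range[where A = A, OF A] closed_convex_hull_real_num_range[where A = A, OF A]
    by blast
qed

end
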